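(* Let $n,d\ge 1$ be integers, let $C\subset\mathbb{R}^{n+d}$ be a convex body, let $S=C\cap(\mathbb{Z}^n\times\mathbb{R}^d)$, and let $K=\operatorname{proj}_{\mathbb{R}^n}(C)$. Assume that there exist $z_0\in\mathbb{R}^n$ and $k\ge 3e(n+d)$ such that $z_0+k\,\mathbb{B}_\infty^n\subseteq K$. Then the set of centerpoints $\mathcal{C}(S)$ is nonempty, and every $\hat y\in\mathcal{C}(S)$ satisfies $$h_S(\hat y)\ \ge\ \frac{1}{2e}\,\mathcal{H}_d(S)\ \ge\ \frac{1}{2^n e}\,\mathcal{H}_d(S).$$
   Context: A convex body is a compact convex set with nonempty interior. Points of $\mathbb{R}^{n+d}=\mathbb{R}^n\times\mathbb{R}^d$ are written $(z,x)$, and $\operatorname{proj}_{\mathbb{R}^n}(z,x)=z$; the projection of a set is its image. $\mathbb{B}_\infty^n=\{u\in\mathbb{R}^n:\|u\|_\infty\le 1\}$. For a measurable set $A\subseteq\mathbb{Z}^n\times\mathbb{R}^d$, the mixed-integer volume is $\mathcal{H}_d(A)=\sum_{z\in\mathbb{Z}^n}\operatorname{vol}_d(A_z)$, where $A_z=\{x\in\mathbb{R}^d:(z,x)\in A\}$ and $\operatorname{vol}_d$ is $d$-dimensional Lebesgue measure. A closed halfspace in $\mathbb{R}^{n+d}$ is a set $\{y: a^{\mathsf T}y\ge c\}$ with $a\in\mathbb{R}^{n+d}\setminus\{0\}$, $c\in\mathbb{R}$. For $y\in S$ the halfspace depth is $h_S(y)=\inf\{\mathcal{H}_d(S\cap H):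 H\subset\mathbb{R}^{n+d}\text{ a closed halfspace with }y\in H\}$. The set of centerpoints of $S$ is $\mathcal{C}(S)=\arg\max_{y\in S}h_S(y)$, i.e. the set of points of $S$ at which $h_S$ attains its maximum over $S$. Here $e$ is the base of the natural logarithm. *)

theory Defs
  imports "HOL-Analysis.Analysis"
begin

definition convex_body :: "'a::euclidean_space set \<Rightarrow> bool" where
  "convex_body C \<longleftrightarrow> compact C \<and> convex C \<and> interior C \<noteq> {}"

definition integer_points :: "(real ^ 'n) set" where
  "integer_points = {z. \<forall>i. z $ i \<in> \<int>}"

definition sup_norm_ball :: "(real ^ 'n) set" where
  "sup_norm_ball = {u. infnorm u \<le> 1}"

(* The volume takes values in ennreal, so the sum and the infimum below always
   exist and no convention for divergence is involved.  Only the fibres over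
   integer points enter. *)
definition mi_volume :: "((real ^ 'n) \<times> (real ^ 'd)) set \<Rightarrow> ennreal" where
  "mi_volume A = (\<Sum>\<^sub>\<infinity>z\<in>integer_points. emeasure lebesgue {x. (z, x) \<in> A})"

definition closed_halfspace :: "'a::euclidean_space set \<Rightarrow> bool" where
  "closed_halfspace H \<longleftrightarrow> (\<exists>a c. a \<noteq> 0 \<and> H = {y. a \<bullet> y \<ge> c})"

definition halfspace_depth ::
    "((real ^ 'n) \<times> (real ^ 'd)) set \<Rightarrow> (real ^ 'n) \<times> (real ^ 'd) \<Rightarrow> ennreal" where
  "halfspace_depth S y = (INF H\<in>{H. closed_halfspace H \<and> y \<in> H}. mi_volume (S \<inter> H))"

definition centerpoints ::
    "((real ^ 'n) \<times> (real ^ 'd)) set \<Rightarrow> ((real ^ 'n) \<times> (real ^ 'd)) set" where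
  "centerpoints S = {y \<in> S. \<forall>y'\<in>S. halfspace_depth S y' \<le> halfspace_depth S y}"

end

(* Put N = n + d and l = 1/(2k). A unit cell of the integer lattice in R^n is small compared with K:
   any shift by a vector of the half unit cube is the R^n-part of l w - l (z0, 0) for some w in C. Moving
   fibres over nearest integer points by such l w therefore compares the mixed-integer volume with
   Lebesgue measure: H_d(S) is at least vol((1-l) C), and the part of S where a.p < t has volume at
   most that of the part of (1+l) C where a.q < t + l max_C a. Rounding the centroid c of C in the same
   way gives y = (1-l) c + l w in S. If v maximises a on C, the map p -> (1-l) p + 2 l v sends
   the cap of C beyond c into the part of (1+l) C where a.q >= a.y + l a.v, and by Gruenbaum that cap
   has at least the fraction 1/e of vol(C). Subtracting the volume below y from H_d(S) leaves at least
   H_d(S)/(2e), since N l <= 1/(6e). A centerpoint is at least as deep as y.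

   Gruenbaum's inequality: by Brunn-Minkowski the tail F(t) = vol(C, a.x > t)/vol(C) is
   log-concave, so Jensen gives -ln F(a.c) <= E(-ln F(a.X)) for X uniform on C; the right-hand side
   is at most 1 because F(a.X) is uniformly distributed. Brunn-Minkowski, in its multiplicative form,
   is proved by the Hadwiger-Ohmann induction on the number of boxes. *)
theory Submission imports Defs "HOL-Probability.Probability" begin

section \<open>The Brunn-Minkowski inequality\<close>

lemma lmeasurable_halfspace_le:
  fixes a :: "'a::euclidean_space"
  assumes "S \<in> lmeasurable"
  shows "S \<inter> {x. a \<bullet> x \<le> c} \<in> lmeasurable"
  by (rule fmeasurable_Int_fmeasurable[OF assms]) (simp add: borel_closed closed_halfspace_le)

lemma lmeasurable_halfspace_ge:
  fixes a :: "'a::euclidean_space"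
  assumes "S \<in> lmeasurable"
  shows "S \<inter> {x. a \<bullet> x \<ge> c} \<in> lmeasurable"
  by (rule fmeasurable_Int_fmeasurable[OF assms]) (simp add: borel_closed closed_halfspace_ge)

lemma measure_halfspace_split:
  fixes a :: "'a::euclidean_space"
  assumes S: "S \<in> lmeasurable" and "a \<noteq> 0"
  shows "measure lebesgue S =
    measure lebesgue (S \<inter> {x. a \<bullet> x \<le> c}) + measure lebesgue (S \<inter> {x. a \<bullet> x \<ge> c})"
proof -
  have "negligible (S \<inter> {x. a \<bullet> x \<le> c} \<inter> (S \<inter> {x. a \<bullet> x \<ge> c}))"
    by (rule negligible_subset[OF negligible_hyperplane[of a c]]) (use assms in auto)
  then have "measure lebesgue (S \<inter> {x. a \<bullet> x \<le> c} \<union> S \<inter> {x. a \<bullet> x \<ge> c}) =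
    measure lebesgue (S \<inter> {x. a \<bullet> x \<le> c}) + measure lebesgue (S \<inter> {x. a \<bullet> x \<ge> c})"
    using lmeasurable_halfspace_le[OF S] lmeasurable_halfspace_ge[OF S]
    by (simp add: measure_Un3 negligible_imp_measure0)
  moreover have "S \<inter> {x. a \<bullet> x \<le> c} \<union> S \<inter> {x. a \<bullet> x \<ge> c} = S"
    by auto
  ultimately show ?thesis by simp
qed

text \<open>Dominated convergence: off the hyperplane \<open>a \<bullet> x = c\<close>, which is
  null because \<open>a \<noteq> 0\<close>, the indicators converge pointwise, and the indicator of
  \<open>S\<close> dominates them.\<close>

lemma continuous_measure_halfspace:
  fixes a :: "'a::euclidean_space"
  assumes S: "S \<in> lmeasurable" and "a \<noteq> 0"
  shows "continuous_on UNIV (\<lambda>c. measure lebesgue (S \<inter> {x. a \<bullet> x \<le> c}))"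
  unfolding continuous_on_sequentially o_def
proof safe
  fix X and c :: real
  assume X: "X \<longlonglongrightarrow> c"
  have AE: "AE x in lebesgue. a \<bullet> x \<noteq> c"
    by (rule AE_I'[of "{x. a \<bullet> x = c}"])
       (use assms negligible_hyperplane[of a c] in \<open>auto simp: negligible_iff_null_sets\<close>)
  have "(\<lambda>n. \<integral>x. indicator (S \<inter> {x. a \<bullet> x \<le> X n}) x \<partial>lebesgue) \<longlonglongrightarrow>
     ((\<integral>x. indicator (S \<inter> {x. a \<bullet> x \<le> c}) x \<partial>lebesgue) :: real)"
  proof (rule integral_dominated_convergence[where w = "indicator S"])
    show "AE x in lebesgue. (\<lambda>n. indicator (S \<inter> {x. a \<bullet> x \<le> X n}) x :: real)
        \<longlonglongrightarrow> indicator (S \<inter> {x. a \<bullet> x \<le> c}) x"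
      using AE
    proof eventually_elim
      case (elim x)
      then consider "a \<bullet> x < c" | "c < a \<bullet> x" by linarith
      then show ?case
      proof cases
        case 1
        then have "eventually (\<lambda>n. a \<bullet> x < X n) sequentially"
          using X order_tendstoD(1) by blast
        then have "eventually (\<lambda>n. indicator (S \<inter> {x. a \<bullet> x \<le> X n}) x = (indicator (S \<inter> {x. a \<bullet> x \<le> c}) x :: real)) sequentially"
          by eventually_elim (use 1 in \<open>auto simp: indicator_def\<close>)
        then show ?thesis by (rule tendsto_eventually)
      next
        case 2
        then have "eventually (\<lambda>n. a \<bullet> x > X n) sequentially"
          using X order_tendstoD(2) by blast
        then have "eventually (\<lambda>n. indicator (S \<inter> {x. a \<bullet> x \<le> X n}) x = (indicator (S \<inter> {x. a \<bullet> x \<le> c}) x :: real)) sequentially"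
          by eventually_elim (use 2 in \<open>auto simp: indicator_def\<close>)
        then show ?thesis by (rule tendsto_eventually)
      qed
    qed
    show "integrable lebesgue (indicator S :: 'a \<Rightarrow> real)"
      using S by (intro integrable_real_indicator) (simp_all only: fmeasurable_def mem_Collect_eq infinity_ennreal_def)
    show "indicator (S \<inter> {x. a \<bullet> x \<le> c}) \<in> borel_measurable lebesgue"
      "indicator (S \<inter> {x. a \<bullet> x \<le> X n}) \<in> borel_measurable lebesgue" for n
      by (intro borel_measurable_indicator fmeasurableD lmeasurable_halfspace_le[OF S])+
  qed (auto simp: indicator_def)
  then show "(\<lambda>n. measure lebesgue (S \<inter> {x. a \<bullet> x \<le> X n})) \<longlonglongrightarrow> measure lebesgue (S \<inter> {x. a \<bullet> x \<le> c})"
    by simp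
qed

text \<open>Intermediate value theorem: a bounded set lies strictly between two parallel
  hyperplanes, so the volume below level \<open>c\<close> runs continuously from 0 to the full
  volume. It provides both the proportional cut in the Hadwiger-Ohmann step and the quantile in
  \<open>halfspace_tail_uniform\<close>.\<close>

lemma halfspace_prescribed_measure:
  fixes a :: "'a::euclidean_space"
  assumes S: "S \<in> lmeasurable" and "bounded S" and a: "a \<noteq> 0" and "0 \<le> r" "r \<le> 1"
  obtains c where "measure lebesgue (S \<inter> {x. a \<bullet> x \<le> c}) = r * measure lebesgue S"
proof -
  obtain B where B: "\<And>x. x \<in> S \<Longrightarrow> norm x \<le> B"
    using \<open>bounded S\<close> by (auto simp: bounded_iff)
  define b where "b = norm a * \<bar>B\<bar> + 1"
  have b: "-b < a \<bullet> x \<and> a \<bullet> x < b" if "x \<in> S" for x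
  proof -
    have "\<bar>a \<bullet> x\<bar> \<le> norm a * norm x" by (rule Cauchy_Schwarz_ineq2)
    also have "\<dots> \<le> norm a * \<bar>B\<bar>" using B[OF that] by (intro mult_left_mono) auto
    finally show ?thesis by (auto simp: b_def)
  qed
  let ?f = "\<lambda>c. measure lebesgue (S \<inter> {x. a \<bullet> x \<le> c})"
  have "S \<inter> {x. a \<bullet> x \<le> -b} = {}" "S \<inter> {x. a \<bullet> x \<le> b} = S" "-b \<le> b"
    using b by (force simp: b_def intro: add_nonneg_nonneg)+
  then have "?f (-b) \<le> r * measure lebesgue S" "r * measure lebesgue S \<le> ?f b" "-b \<le> b"
    using assms by (auto simp: mult_left_le_one_le)
  then obtain c where "?f c = r * measure lebesgue S"
    using IVT'[of ?f "-b" _ b] continuous_measure_halfspace[OF S a] continuous_on_subset by blast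
  then show thesis by (rule that)
qed

section \<open>Finite families of non-overlapping boxes\<close>

text \<open>Boxes with empty interior are excluded, so that every member has positive volume and the
  cardinality is a meaningful induction measure.\<close>

definition box_family :: "'a::euclidean_space set set \<Rightarrow> bool" where
  "box_family p \<longleftrightarrow> finite p \<and> (\<forall>K\<in>p. (\<exists>a b. K = cbox a b) \<and> interior K \<noteq> {}) \<and>
     pairwise (\<lambda>K L. interior K \<inter> interior L = {}) p"

lemma box_familyD:
  assumes "box_family p"
  shows "finite p" "K \<in> p \<Longrightarrow> \<exists>a b. K = cbox a b" "K \<in> p \<Longrightarrow> interior K \<noteq> {}"
    "K \<in> p \<Longrightarrow> L \<in> p \<Longrightarrow> K \<noteq> L \<Longrightarrow> interior K \<inter> interior L = {}"
  using assms by (auto simp: box_family_def pairwise_def)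

lemma box_family_compact:
  assumes "box_family p"
  shows "compact (\<Union>p)"
  using assms unfolding box_family_def by (intro compact_Union) auto

lemma box_family_measure_pos:
  assumes "box_family p" "p \<noteq> {}"
  shows "measure lebesgue (\<Union>p) > 0"
proof -
  obtain K where K: "K \<in> p" using assms by blast
  then obtain a b where ab: "K = cbox a b" "interior K \<noteq> {}"
    using box_familyD(2,3)[OF assms(1) K] by blast
  have "0 < measure lebesgue K"
    using ab by (simp add: interior_cbox content_pos_lt_eq box_ne_empty)
  also have "\<dots> \<le> measure lebesgue (\<Union>p)"
    using K ab box_family_compact[OF assms(1)]
    by (intro measure_mono_fmeasurable) (auto simp: lmeasurable_compact fmeasurableD)
  finally show ?thesis .
qed

text \<open>Pieces that degenerate under the cut are thrown away: the result is again a
  \<open>box_family\<close>, and the number of boxes drops as soon as some box lies on the other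
  side.\<close>

definition cut_family :: "'a::euclidean_space set \<Rightarrow> 'a set set \<Rightarrow> 'a set set" where
  "cut_family H p = (\<lambda>K. K \<inter> H) ` {K \<in> p. interior (K \<inter> H) \<noteq> {}}"

text \<open>A hyperplane orthogonal to a basis vector cuts a box into boxes. The discarded pieces
  are finitely many degenerate boxes, hence negligible, so no volume is lost.\<close>

lemma cut_family:
  fixes p :: "'a::euclidean_space set set"
  assumes p: "box_family p" and i: "i \<in> Basis"
    and H: "H = {x. i \<bullet> x \<le> c} \<or> H = {x. i \<bullet> x \<ge> c}"
  shows "box_family (cut_family H p)" "card (cut_family H p) \<le> card p"
    "\<Union>(cut_family H p) \<subseteq> \<Union>p \<inter> H"
    "measure lebesgue (\<Union>(cut_family H p)) = measure lebesgue (\<Union>p \<inter> H)"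
proof -
  have fin: "finite p" using p by (simp add: box_family_def)
  have box: "\<exists>a b. K \<inter> H = cbox a b" if K: "K \<in> p" for K
  proof -
    obtain a b where "K = cbox a b" using box_familyD(2)[OF p K] by blast
    moreover have "H = {x. x \<bullet> i \<le> c} \<or> H = {x. x \<bullet> i \<ge> c}"
      using H by (simp add: inner_commute)
    ultimately show ?thesis
      using interval_split[OF i, of a b c] by blast
  qed
  show sub: "\<Union>(cut_family H p) \<subseteq> \<Union>p \<inter> H" by (auto simp: cut_family_def)
  show "card (cut_family H p) \<le> card p"
    unfolding cut_family_def using fin
    by (intro order_trans[OF card_image_le]) (auto intro: card_mono)
  have "pairwise (\<lambda>K L. interior K \<inter> interior L = {}) (cut_family H p)"
  proof (rule pairwiseI)
    fix K L assume KL: "K \<in> cut_family H p" "L \<in> cut_family H p" "K \<noteq> L"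
    then obtain K' L' where *: "K' \<in> p" "L' \<in> p" "K = K' \<inter> H" "L = L' \<inter> H"
      unfolding cut_family_def by blast
    then have "interior K' \<inter> interior L' = {}"
      using box_familyD(4)[OF p] KL(3) by blast
    then show "interior K \<inter> interior L = {}"
      using * by auto
  qed
  moreover have "\<forall>K\<in>cut_family H p. (\<exists>a b. K = cbox a b) \<and> interior K \<noteq> {}"
    using box unfolding cut_family_def by blast
  ultimately show "box_family (cut_family H p)"
    using fin by (simp add: box_family_def cut_family_def)
  then have compact: "compact (\<Union>(cut_family H p))" by (rule box_family_compact)
  define N where "N = \<Union>((\<lambda>K. K \<inter> H) ` {K \<in> p. interior (K \<inter> H) = {}})"
  have "negligible N"
    unfolding N_def
  proof (rule negligible_Union)
    fix t assume "t \<in> (\<lambda>K. K \<inter> H) ` {K \<in> p. interior (K \<inter> H) = {}}"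
    then obtain K where K: "K \<in> p" "t = K \<inter> H" "interior t = {}" by blast
    with box obtain a b where "t = cbox a b" by blast
    with K(3) show "negligible t" by (simp add: negligible_interval(1))
  qed (use fin in simp)
  then have "N \<in> null_sets lebesgue" by (simp add: negligible_iff_null_sets)
  then have "measure lebesgue (\<Union>(cut_family H p) \<union> N) = measure lebesgue (\<Union>(cut_family H p))"
    using compact by (intro measure_Un_null_set) (simp_all add: lmeasurable_compact fmeasurableD)
  moreover have "\<Union>p \<inter> H = \<Union>(cut_family H p) \<union> N"
    unfolding N_def cut_family_def by blast
  ultimately show "measure lebesgue (\<Union>(cut_family H p)) = measure lebesgue (\<Union>p \<inter> H)"
    by simp
qed

lemma card_cut_family_less:
  assumes "finite p" "K \<in> p" "interior (K \<inter> H) = {}"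
  shows "card (cut_family H p) < card p"
proof -
  have "card (cut_family H p) \<le> card {K \<in> p. interior (K \<inter> H) \<noteq> {}}"
    unfolding cut_family_def using assms by (intro card_image_le) auto
  also have "\<dots> < card p" using assms by (intro psubset_card_mono) auto
  finally show ?thesis .
qed

text \<open>\<open>M\<close> contains the box whose side lengths are the weighted arithmetic means
  of the given side lengths. Volumes are products of side lengths, so weighted AM-GM in each
  coordinate gives the bound.\<close>

lemma brunn_minkowski_cbox:
  fixes a b :: "'a::euclidean_space"
  assumes int: "interior (cbox a b) \<noteq> {}" "interior (cbox a' b') \<noteq> {}"
    and s: "0 < s" "s < 1" and M: "M \<in> lmeasurable"
    and sub: "\<And>x y. x \<in> cbox a b \<Longrightarrow> y \<in> cbox a' b' \<Longrightarrow> (1 - s) *\<^sub>R x + s *\<^sub>R y \<in> M"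
  shows "measure lebesgue (cbox a b) powr (1 - s) * measure lebesgue (cbox a' b') powr s
    \<le> measure lebesgue M"
proof -
  define l u where "l = (1 - s) *\<^sub>R a + s *\<^sub>R a'" and "u = (1 - s) *\<^sub>R b + s *\<^sub>R b'"
  have pos: "b \<bullet> i - a \<bullet> i > 0" "b' \<bullet> i - a' \<bullet> i > 0" if "i \<in> Basis" for i
    using int that by (simp_all add: interior_cbox box_ne_empty)
  have lu: "u \<bullet> i - l \<bullet> i = (1 - s) * (b \<bullet> i - a \<bullet> i) + s * (b' \<bullet> i - a' \<bullet> i)" for i
    by (simp add: l_def u_def algebra_simps)
  have lu_pos: "u \<bullet> i - l \<bullet> i > 0" if "i \<in> Basis" for i
    unfolding lu using pos[OF that] s by (intro add_pos_pos mult_pos_pos) auto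
  have "cbox l u \<subseteq> M"
  proof
    fix z assume z: "z \<in> cbox l u"
    have mid: "c \<le> c + r * (d - c) \<and> c + r * (d - c) \<le> d" if "0 < d - c" "0 \<le> r" "r \<le> 1" for c d r :: real
    proof -
      have "r * (d - c) \<le> d - c" using that by (intro mult_left_le_one_le) auto
      moreover have "0 \<le> r * (d - c)" using that by simp
      ultimately show ?thesis by linarith
    qed
    \<comment> \<open>\<open>t i\<close> is the relative position of \<open>z\<close> along the i-th
      side of the combined box; \<open>x\<close> and \<open>y\<close> take the same relative
      positions in the two given boxes.\<close>
    define t where "t i = (z \<bullet> i - l \<bullet> i) / (u \<bullet> i - l \<bullet> i)" for i
    have t: "0 \<le> t i" "t i \<le> 1" "t i * (u \<bullet> i - l \<bullet> i) = z \<bullet> i - l \<bullet> i" if "i \<in> Basis" for i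
      using z lu_pos[OF that] that by (auto simp: t_def mem_box)
    define x where "x = (\<Sum>i\<in>Basis. (a \<bullet> i + t i * (b \<bullet> i - a \<bullet> i)) *\<^sub>R i)"
    define y where "y = (\<Sum>i\<in>Basis. (a' \<bullet> i + t i * (b' \<bullet> i - a' \<bullet> i)) *\<^sub>R i)"
    have "x \<in> cbox a b"
      unfolding mem_box x_def using t pos mid
      by (auto intro!: mult_nonneg_nonneg simp: less_imp_le)
    moreover have "y \<in> cbox a' b'"
      unfolding mem_box y_def using t pos mid
      by (auto intro!: mult_nonneg_nonneg simp: less_imp_le)
    moreover have "z = (1 - s) *\<^sub>R x + s *\<^sub>R y"
    proof (rule euclidean_eqI)
      fix i :: 'a assume i: "i \<in> Basis"
      have "((1 - s) *\<^sub>R x + s *\<^sub>R y) \<bullet> i = l \<bullet> i + t i * (u \<bullet> i - l \<bullet> i)"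
      proof -
        have "x \<bullet> i = a \<bullet> i + t i * (b \<bullet> i - a \<bullet> i)" "y \<bullet> i = a' \<bullet> i + t i * (b' \<bullet> i - a' \<bullet> i)"
          using i by (simp_all add: x_def y_def)
        note xy = this
        show ?thesis
          unfolding lu unfolding l_def inner_add_left inner_scaleR_left xy by (simp add: algebra_simps)
      qed
      then show "z \<bullet> i = ((1 - s) *\<^sub>R x + s *\<^sub>R y) \<bullet> i"
        using t(3)[OF i] by simp
    qed
    ultimately show "z \<in> M" using sub by blast
  qed
  then have "measure lebesgue (cbox l u) \<le> measure lebesgue M"
    using M by (intro measure_mono_fmeasurable) auto
  moreover have "measure lebesgue (cbox a b) powr (1 - s) * measure lebesgue (cbox a' b') powr s
    \<le> measure lebesgue (cbox l u)"
  proof -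
    have "measure lebesgue (cbox a b) = (\<Prod>i\<in>Basis. b \<bullet> i - a \<bullet> i)"
      "measure lebesgue (cbox a' b') = (\<Prod>i\<in>Basis. b' \<bullet> i - a' \<bullet> i)"
      "measure lebesgue (cbox l u) = (\<Prod>i\<in>Basis. u \<bullet> i - l \<bullet> i)"
      using pos lu_pos by (auto simp: content_cbox less_imp_le inner_diff_left)
    moreover have "(\<Prod>i\<in>Basis. b \<bullet> i - a \<bullet> i) powr (1 - s) * (\<Prod>i\<in>Basis. b' \<bullet> i - a' \<bullet> i) powr s
      = (\<Prod>i\<in>Basis. (b \<bullet> i - a \<bullet> i) powr (1 - s) * (b' \<bullet> i - a' \<bullet> i) powr s)"
      using pos by (auto simp: prod_powr_distrib prod.distrib less_imp_le)
    moreover have "\<dots> \<le> (\<Prod>i\<in>Basis. u \<bullet> i - l \<bullet> i)"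
      unfolding lu using pos s by (intro prod_mono) (auto intro!: Youngs_inequality_0)
    ultimately show ?thesis by simp
  qed
  ultimately show ?thesis by linarith
qed

text \<open>Two boxes with disjoint interiors have, in some coordinate, side intervals that do not
  overlap; the common or intermediate value \<open>c\<close> is taken at the upper end of the lower
  interval. Then each closed side of the hyperplane loses at least one box of the family.\<close>

lemma box_family_separation:
  fixes p :: "'a::euclidean_space set set"
  assumes p: "box_family p" and card: "2 \<le> card p"
  obtains i c K L where "i \<in> Basis" "K \<in> p" "L \<in> p"
    "interior (K \<inter> {x. i \<bullet> x \<ge> c}) = {}" "interior (L \<inter> {x. i \<bullet> x \<le> c}) = {}"
proof -
  have empty: "interior (cbox a b \<inter> {x. i \<bullet> x \<ge> c}) = {}" if "b \<bullet> i \<le> c" "i \<in> Basis" for a b i :: 'a and c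
  proof -
    have "interior (cbox a b \<inter> {x. i \<bullet> x \<ge> c}) \<subseteq> box a b \<inter> {x. i \<bullet> x \<ge> c}"
      using interior_subset by (fastforce simp: interior_cbox)
    also have "\<dots> = {}" using that by (force simp: box_def inner_commute)
    finally show ?thesis by blast
  qed
  have empty': "interior (cbox a b \<inter> {x. i \<bullet> x \<le> c}) = {}" if "c \<le> a \<bullet> i" "i \<in> Basis" for a b i :: 'a and c
  proof -
    have "interior (cbox a b \<inter> {x. i \<bullet> x \<le> c}) \<subseteq> box a b \<inter> {x. i \<bullet> x \<le> c}"
      using interior_subset by (fastforce simp: interior_cbox)
    also have "\<dots> = {}" using that by (force simp: box_def inner_commute)
    finally show ?thesis by blast
  qed
  obtain K where K: "K \<in> p" using card by fastforce
  have "p - {K} \<noteq> {}"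
  proof
    assume "p - {K} = {}"
    then have "p = {K}" using K by blast
    then show False using card by simp
  qed
  then obtain L where L: "L \<in> p" "L \<noteq> K" by blast
  obtain a b where ab: "K = cbox a b" using box_familyD(2)[OF p K] by blast
  obtain a' b' where ab': "L = cbox a' b'" using box_familyD(2)[OF p L(1)] by blast
  have "box a b \<noteq> {}" "box a' b' \<noteq> {}" "box a b \<inter> box a' b' = {}"
    using box_familyD(3)[OF p K] box_familyD(3)[OF p L(1)] box_familyD(4)[OF p K L(1)] L(2)
    by (auto simp: ab ab' interior_cbox)
  then obtain i where i: "i \<in> Basis" and "b \<bullet> i \<le> a' \<bullet> i \<or> b' \<bullet> i \<le> a \<bullet> i"
    unfolding disjoint_interval box_ne_empty by (meson not_less)
  then consider "b \<bullet> i \<le> a' \<bullet> i" | "b' \<bullet> i \<le> a \<bullet> i" by blast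
  then show thesis
  proof cases
    case 1
    then show thesis
      using that[OF i K L(1)] empty[OF _ i] empty'[OF _ i] ab ab' by blast
  next
    case 2
    then show thesis
      using that[OF i L(1) K] empty[OF _ i] empty'[OF _ i] ab ab' by blast
  qed
qed

section \<open>The Hadwiger-Ohmann induction\<close>

text \<open>The multiplicative, dimension-free form. Quantifying over measurable supersets
  \<open>M\<close> of the Minkowski combination avoids asking whether the combination itself is
  measurable, and lets \<open>M\<close> be cut by a halfspace in the induction.\<close>

definition brunn_minkowski :: "'a::euclidean_space set \<Rightarrow> 'a set \<Rightarrow> bool" where
  "brunn_minkowski A B \<longleftrightarrow> (\<forall>s M. 0 < s \<longrightarrow> s < 1 \<longrightarrow> M \<in> lmeasurable \<longrightarrow>
     (\<forall>x\<in>A. \<forall>y\<in>B. (1 - s) *\<^sub>R x + s *\<^sub>R y \<in> M) \<longrightarrow>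
     measure lebesgue A powr (1 - s) * measure lebesgue B powr s \<le> measure lebesgue M)"

lemma brunn_minkowskiD:
  assumes "brunn_minkowski A B" "0 < s" "s < 1" "M \<in> lmeasurable"
    "\<And>x y. x \<in> A \<Longrightarrow> y \<in> B \<Longrightarrow> (1 - s) *\<^sub>R x + s *\<^sub>R y \<in> M"
  shows "measure lebesgue A powr (1 - s) * measure lebesgue B powr s \<le> measure lebesgue M"
  using assms by (simp add: brunn_minkowski_def)

lemma brunn_minkowski_commute:
  assumes "brunn_minkowski A B"
  shows "brunn_minkowski B A"
  unfolding brunn_minkowski_def
proof (intro allI impI)
  fix s :: real and M
  assume "0 < s" "s < 1" "M \<in> lmeasurable" "\<forall>x\<in>B. \<forall>y\<in>A. (1 - s) *\<^sub>R x + s *\<^sub>R y \<in> M"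
  then show "measure lebesgue B powr (1 - s) * measure lebesgue A powr s \<le> measure lebesgue M"
    using brunn_minkowskiD[OF assms, of "1 - s" M] by (simp add: add.commute mult.commute)
qed

text \<open>Cut \<open>p\<close> so that both halves have fewer boxes, and cut \<open>q\<close> by a
  parallel hyperplane in the same volume ratio. Combinations of the lower halves and of the upper
  halves lie on opposite sides of a third parallel hyperplane, so the two inductive bounds add up to
  the bound for \<open>M\<close>.\<close>

lemma brunn_minkowski_cut:
  fixes p q :: "'a::euclidean_space set set"
  assumes p: "box_family p" and q: "box_family q" "q \<noteq> {}" and card: "2 \<le> card p"
    and IH: "\<And>p' q' :: 'a set set. box_family p' \<Longrightarrow> box_family q' \<Longrightarrow> p' \<noteq> {} \<Longrightarrow> q' \<noteq> {} \<Longrightarrow>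
      card p' + card q' < card p + card q \<Longrightarrow> brunn_minkowski (\<Union>p') (\<Union>q')"
  shows "brunn_minkowski (\<Union>p) (\<Union>q)"
  unfolding brunn_minkowski_def
proof (intro allI impI)
  fix s :: real and M
  assume s: "0 < s" "s < 1" and M: "M \<in> lmeasurable"
    and sub: "\<forall>x\<in>\<Union>p. \<forall>y\<in>\<Union>q. (1 - s) *\<^sub>R x + s *\<^sub>R y \<in> M"
  let ?m = "measure lebesgue"
  obtain i c K L where i: "i \<in> Basis" and KL: "K \<in> p" "L \<in> p"
    "interior (K \<inter> {x. i \<bullet> x \<ge> c}) = {}" "interior (L \<inter> {x. i \<bullet> x \<le> c}) = {}"
    using box_family_separation[OF p card] .
  have i0: "i \<noteq> 0" using i by auto
  have fin: "finite p" "finite q" using p q by (simp_all add: box_familyD)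
  have lm: "\<Union>p \<in> lmeasurable" "\<Union>q \<in> lmeasurable"
    using p q by (simp_all add: box_family_compact lmeasurable_compact)
  have pos: "?m (\<Union>p) > 0" "?m (\<Union>q) > 0"
    using p q card by (auto intro!: box_family_measure_pos)
  define p1 p2 where "p1 = cut_family {x. i \<bullet> x \<le> c} p" and "p2 = cut_family {x. i \<bullet> x \<ge> c} p"
  have p1: "box_family p1" "card p1 < card p" "\<Union>p1 \<subseteq> \<Union>p \<inter> {x. i \<bullet> x \<le> c}"
    "?m (\<Union>p1) = ?m (\<Union>p \<inter> {x. i \<bullet> x \<le> c})"
    unfolding p1_def
    using cut_family[OF p i disjI1[OF refl]] card_cut_family_less[OF fin(1) KL(2,4)] by simp_all
  have p2: "box_family p2" "card p2 < card p" "\<Union>p2 \<subseteq> \<Union>p \<inter> {x. i \<bullet> x \<ge> c}"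
    "?m (\<Union>p2) = ?m (\<Union>p \<inter> {x. i \<bullet> x \<ge> c})"
    unfolding p2_def
    using cut_family[OF p i disjI2[OF refl]] card_cut_family_less[OF fin(1) KL(1,3)] by simp_all
  have split_p: "?m (\<Union>p) = ?m (\<Union>p1) + ?m (\<Union>p2)"
    unfolding p1 p2 by (rule measure_halfspace_split[OF lm(1) i0])
  have ne: "r \<inter> H \<in> cut_family H p" if "r \<in> p" "interior (r \<inter> H) \<noteq> {}" for r H
    using that by (auto simp: cut_family_def)
  \<comment> \<open>A box whose two pieces both had empty interior would have its interior inside
    the hyperplane, which is impossible. So \<open>K\<close> survives in \<open>p1\<close> and
    \<open>L\<close> in \<open>p2\<close>.\<close>
  have nonempty: "interior (K \<inter> {x. i \<bullet> x \<le> c}) \<noteq> {}" "interior (L \<inter> {x. i \<bullet> x \<ge> c}) \<noteq> {}"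
  proof -
    have *: "interior (J \<inter> H) \<noteq> {}" if J: "J \<in> p" and HH: "interior (J \<inter> H') = {}"
      and H: "{H, H'} = {{x. i \<bullet> x \<le> c}, {x. i \<bullet> x \<ge> c}}" for J H H'
    proof
      assume "interior (J \<inter> H) = {}"
      with HH H have e: "interior (J \<inter> {x. i \<bullet> x \<le> c}) = {}" "interior (J \<inter> {x. i \<bullet> x \<ge> c}) = {}"
        by (auto simp: doubleton_eq_iff)
      obtain y where y: "y \<in> interior J" using box_familyD(3)[OF p J] by blast
      have "interior J \<subseteq> {x. i \<bullet> x = c}"
      proof
        fix x assume x: "x \<in> interior J"
        show "x \<in> {x. i \<bullet> x = c}"
        proof (rule ccontr)
          assume "x \<notin> {x. i \<bullet> x = c}"
          then have "x \<in> interior {x. i \<bullet> x \<le> c} \<or> x \<in> interior {x. i \<bullet> x \<ge> c}"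
            using i0 by auto
          with x e show False by auto
        qed
      qed
      then have "interior J \<subseteq> interior {x. i \<bullet> x = c}" by (simp add: interior_maximal)
      then show False using y i0 by (simp add: interior_hyperplane)
    qed
    show "interior (K \<inter> {x. i \<bullet> x \<le> c}) \<noteq> {}" by (rule *[OF KL(1,3)]) auto
    show "interior (L \<inter> {x. i \<bullet> x \<ge> c}) \<noteq> {}" by (rule *[OF KL(2,4)]) auto
  qed
  have ne12: "p1 \<noteq> {}" "p2 \<noteq> {}"
    using ne[OF KL(1) nonempty(1)] ne[OF KL(2) nonempty(2)] by (auto simp: p1_def p2_def)
  have pos12: "?m (\<Union>p1) > 0" "?m (\<Union>p2) > 0"
    using box_family_measure_pos[OF p1(1) ne12(1)] box_family_measure_pos[OF p2(1) ne12(2)] by blast+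
  define r where "r = ?m (\<Union>p1) / ?m (\<Union>p)"
  have r: "0 < r" "r < 1" and mp1: "?m (\<Union>p1) = r * ?m (\<Union>p)"
    and mp2: "?m (\<Union>p2) = (1 - r) * ?m (\<Union>p)"
    using pos pos12 split_p by (auto simp: r_def field_simps)
  obtain c' where c': "?m (\<Union>q \<inter> {x. i \<bullet> x \<le> c'}) = r * ?m (\<Union>q)"
    using halfspace_prescribed_measure[OF lm(2) _ i0, of r] r q(1)
    by (auto simp: box_family_compact compact_imp_bounded)
  define q1 q2 where "q1 = cut_family {x. i \<bullet> x \<le> c'} q" and "q2 = cut_family {x. i \<bullet> x \<ge> c'} q"
  have q1: "box_family q1" "card q1 \<le> card q" "\<Union>q1 \<subseteq> \<Union>q \<inter> {x. i \<bullet> x \<le> c'}"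
    "?m (\<Union>q1) = ?m (\<Union>q \<inter> {x. i \<bullet> x \<le> c'})"
    unfolding q1_def using cut_family[OF q(1) i disjI1[OF refl]] by simp_all
  have q2: "box_family q2" "card q2 \<le> card q" "\<Union>q2 \<subseteq> \<Union>q \<inter> {x. i \<bullet> x \<ge> c'}"
    "?m (\<Union>q2) = ?m (\<Union>q \<inter> {x. i \<bullet> x \<ge> c'})"
    unfolding q2_def using cut_family[OF q(1) i disjI2[OF refl]] by simp_all
  have mq1: "?m (\<Union>q1) = r * ?m (\<Union>q)" using q1 c' by simp
  have mq2: "?m (\<Union>q2) = (1 - r) * ?m (\<Union>q)"
    using q2 c' measure_halfspace_split[OF lm(2) i0, of c'] by (simp add: algebra_simps)
  have ne': "q1 \<noteq> {}" "q2 \<noteq> {}" using mq1 mq2 r pos by auto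
  \<comment> \<open>The level of \<open>(1 - s) *\<^sub>R x + s *\<^sub>R y\<close> when
    \<open>x\<close> lies on the cut of \<open>p\<close> and \<open>y\<close> on the cut of
    \<open>q\<close>.\<close>
  define d where "d = (1 - s) * c + s * c'"
  \<comment> \<open>The exponents add up to 1, so a factor common to both volumes comes out
    linearly. This is why both families are cut in the same ratio.\<close>
  have scale: "(t * a) powr (1 - s) * (t * b) powr s = t * (a powr (1 - s) * b powr s)"
    if "0 < t" "0 < a" "0 < b" for t a b :: real
    using that by (simp add: powr_mult powr_diff field_simps)
  have "r * (?m (\<Union>p) powr (1 - s) * ?m (\<Union>q) powr s) \<le> ?m (M \<inter> {x. i \<bullet> x \<le> d})"
  proof -
    have "brunn_minkowski (\<Union>p1) (\<Union>q1)"
      using IH p1 q1 ne12 ne' by (meson add_less_le_mono)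
    then have "?m (\<Union>p1) powr (1 - s) * ?m (\<Union>q1) powr s \<le> ?m (M \<inter> {x. i \<bullet> x \<le> d})"
    proof (rule brunn_minkowskiD[OF _ s lmeasurable_halfspace_le[OF M]])
      fix x y assume "x \<in> \<Union>p1" "y \<in> \<Union>q1"
      then have "x \<in> \<Union>p" "y \<in> \<Union>q" "i \<bullet> x \<le> c" "i \<bullet> y \<le> c'" using p1 q1 by blast+
      then show "(1 - s) *\<^sub>R x + s *\<^sub>R y \<in> M \<inter> {x. i \<bullet> x \<le> d}"
        using sub s by (auto simp: d_def inner_add_right intro!: add_mono mult_left_mono)
    qed
    then show ?thesis unfolding mp1 mq1 scale[OF r(1) pos] .
  qed
  moreover have "(1 - r) * (?m (\<Union>p) powr (1 - s) * ?m (\<Union>q) powr s) \<le> ?m (M \<inter> {x. i \<bullet> x \<ge> d})"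
  proof -
    have "brunn_minkowski (\<Union>p2) (\<Union>q2)"
      using IH p2 q2 ne12 ne' by (meson add_less_le_mono)
    then have "?m (\<Union>p2) powr (1 - s) * ?m (\<Union>q2) powr s \<le> ?m (M \<inter> {x. i \<bullet> x \<ge> d})"
    proof (rule brunn_minkowskiD[OF _ s lmeasurable_halfspace_ge[OF M]])
      fix x y assume "x \<in> \<Union>p2" "y \<in> \<Union>q2"
      then have "x \<in> \<Union>p" "y \<in> \<Union>q" "i \<bullet> x \<ge> c" "i \<bullet> y \<ge> c'" using p2 q2 by blast+
      then show "(1 - s) *\<^sub>R x + s *\<^sub>R y \<in> M \<inter> {x. i \<bullet> x \<ge> d}"
        using sub s by (auto simp: d_def inner_add_right intro!: add_mono mult_left_mono)
    qed
    moreover have "0 < 1 - r" using r by simp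
    ultimately show ?thesis unfolding mp2 mq2 by (simp only: scale[OF _ pos])
  qed
  ultimately show "?m (\<Union>p) powr (1 - s) * ?m (\<Union>q) powr s \<le> ?m M"
    using measure_halfspace_split[OF M i0, of d] by (simp add: algebra_simps)
qed

lemma brunn_minkowski_boxes:
  fixes p q :: "'a::euclidean_space set set"
  assumes "box_family p" "box_family q" "p \<noteq> {}" "q \<noteq> {}"
  shows "brunn_minkowski (\<Union>p) (\<Union>q)"
  using assms
proof (induction "card p + card q" arbitrary: p q rule: less_induct)
  case less
  have IH: "brunn_minkowski (\<Union>p') (\<Union>q')"
    if "box_family p'" "box_family q'" "p' \<noteq> {}" "q' \<noteq> {}" "card p' + card q' < card p + card q"
    for p' q' :: "'a set set"
    using less.hyps that by blast
  have fin: "finite p" "finite q" using less.prems by (simp_all add: box_familyD)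
  have "card p \<noteq> 0" "card q \<noteq> 0" using fin less.prems by auto
  then consider "2 \<le> card p" | "2 \<le> card q" | "card p = 1" "card q = 1" by linarith
  then show ?case
  proof cases
    case 1
    then show ?thesis using brunn_minkowski_cut[of p q] less.prems IH by blast
  next
    case 2
    have "brunn_minkowski (\<Union>q) (\<Union>p)"
      by (rule brunn_minkowski_cut[OF less.prems(2,1,3) 2]) (use IH in \<open>auto simp: add.commute\<close>)
    then show ?thesis by (rule brunn_minkowski_commute)
  next
    case 3
    then obtain K L where KL: "p = {K}" "q = {L}" by (auto simp: card_1_singleton_iff)
    then obtain a b a' b' where "K = cbox a b" "L = cbox a' b'"
      using box_familyD(2)[OF less.prems(1), of K] box_familyD(2)[OF less.prems(2), of L] by auto
    then show ?thesis
      using KL box_familyD(3)[OF less.prems(1), of K] box_familyD(3)[OF less.prems(2), of L]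
        brunn_minkowski_cbox[of a b a' b']
      by (simp add: brunn_minkowski_def)
  qed
qed

section \<open>From boxes to open sets\<close>

text \<open>An open set is a countable union of closed boxes, so by continuity from below a finite
  subunion already has volume above \<open>v\<close>. Its boxes may overlap; a division of the
  subunion with the degenerate boxes removed is the required family.\<close>

lemma box_family_inner_approx:
  fixes S :: "'a::euclidean_space set"
  assumes S: "open S" "S \<in> lmeasurable" and v: "0 \<le> v" "v < measure lebesgue S"
  obtains p where "box_family p" "p \<noteq> {}" "\<Union>p \<subseteq> S" "v < measure lebesgue (\<Union>p)"
proof -
  obtain D where D: "countable D" "D \<subseteq> Pow S" "\<And>X. X \<in> D \<Longrightarrow> \<exists>a b. X = cbox a b" "\<Union>D = S"
    using open_countable_Union_open_cbox[OF S(1)] by metis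
  have "S \<noteq> {}" using v by auto
  then have "D \<noteq> {}" using D by auto
  define f where "f = from_nat_into D"
  have f: "range f = D"
    unfolding f_def using \<open>D \<noteq> {}\<close> D(1) by (rule range_from_nat_into)
  have "(\<lambda>n. measure lebesgue (\<Union>k\<le>n. f k)) \<longlonglongrightarrow> measure lebesgue (\<Union>n. \<Union>k\<le>n. f k)"
  proof (rule Lim_measure_incseq)
    show "range (\<lambda>n. \<Union>k\<le>n. f k) \<subseteq> sets lebesgue"
    proof safe
      fix n
      have "compact (\<Union>k\<le>n. f k)" using f D(3) by (intro compact_UN) (auto, metis compact_cbox rangeI)
      then show "(\<Union>k\<le>n. f k) \<in> sets lebesgue" by (simp add: lmeasurable_compact fmeasurableD)
    qed
    show "incseq (\<lambda>n. \<Union>k\<le>n. f k)" by (fastforce simp: incseq_def)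
    have "(\<Union>n. \<Union>k\<le>n. f k) = S" using f D(4) by auto
    then show "emeasure lebesgue (\<Union>n. \<Union>k\<le>n. f k) \<noteq> \<infinity>"
      using fmeasurableD2[OF S(2)] by (simp only: infinity_ennreal_def not_False_eq_True)
  qed
  moreover have "(\<Union>n. \<Union>k\<le>n. f k) = S" using f D(4) by auto
  ultimately have "eventually (\<lambda>n. v < measure lebesgue (\<Union>k\<le>n. f k)) sequentially"
    using v(2) by (simp add: order_tendsto_iff)
  then obtain n where n: "v < measure lebesgue (\<Union>k\<le>n. f k)"
    by (auto simp: eventually_sequentially)
  have "\<exists>a b. X = cbox a b" if "X \<in> f ` {..n}" for X using that f D(3) by blast
  then obtain d where d: "d division_of (\<Union>k\<le>n. f k)"
    using elementary_unions_intervals[of "f ` {..n}"] by auto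
  define p where "p = {K \<in> d. interior K \<noteq> {}}"
  have "\<exists>a b. K = cbox a b" if "K \<in> d" for K
    using division_ofD(4)[OF d that] .
  then have p: "box_family p"
    using division_ofD(1,5)[OF d] by (auto simp: box_family_def p_def pairwise_def)
  define N where "N = \<Union>{K \<in> d. interior K = {}}"
  have "negligible N"
    unfolding N_def
  proof (rule negligible_Union)
    fix t assume t: "t \<in> {K \<in> d. interior K = {}}"
    then obtain a b where "t = cbox a b" using division_ofD(4)[OF d] by blast
    with t show "negligible t" by (simp add: negligible_interval(1))
  qed (use division_ofD(1)[OF d] in simp)
  then have "N \<in> null_sets lebesgue" by (simp add: negligible_iff_null_sets)
  then have "measure lebesgue (\<Union>p \<union> N) = measure lebesgue (\<Union>p)"
    using box_family_compact[OF p]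
    by (intro measure_Un_null_set) (simp_all add: lmeasurable_compact fmeasurableD)
  moreover have "\<Union>p \<union> N = (\<Union>k\<le>n. f k)"
    unfolding division_ofD(6)[OF d, symmetric] p_def N_def by blast
  ultimately have m: "v < measure lebesgue (\<Union>p)" using n by simp
  show thesis
  proof (rule that[OF p _ _ m])
    show "p \<noteq> {}" using m v(1) by auto
    have "\<Union>p \<subseteq> (\<Union>k\<le>n. f k)" using \<open>\<Union>p \<union> N = _\<close> by blast
    also have "\<dots> \<subseteq> S" using f D(4) by blast
    finally show "\<Union>p \<subseteq> S" .
  qed
qed

theorem brunn_minkowski_open:
  fixes A B :: "'a::euclidean_space set"
  assumes A: "open A" "A \<in> lmeasurable" and B: "open B" "B \<in> lmeasurable"
  shows "brunn_minkowski A B"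
  unfolding brunn_minkowski_def
proof (intro allI impI)
  fix s :: real and M
  assume s: "0 < s" "s < 1" and M: "M \<in> lmeasurable"
    and sub: "\<forall>x\<in>A. \<forall>y\<in>B. (1 - s) *\<^sub>R x + s *\<^sub>R y \<in> M"
  let ?m = "measure lebesgue"
  show "?m A powr (1 - s) * ?m B powr s \<le> ?m M"
  \<comment> \<open>If one volume vanishes the left-hand side is 0, because
    \<open>0 powr x = 0\<close>. Otherwise both sets can be approximated from inside.\<close>
  proof (cases "?m A = 0 \<or> ?m B = 0")
    case False
    then have pos: "0 < ?m A" "0 < ?m B" by (auto simp: zero_less_measure_iff)
    show ?thesis
    \<comment> \<open>It suffices to prove the bound with a factor \<open>t < 1\<close> on the left,
      which leaves room for inner approximations of relative volume more than
      \<open>t\<close>.\<close>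
    proof (rule field_le_mult_one_interval)
      fix t :: real assume t: "0 < t" "t < 1"
      obtain p where p: "box_family p" "p \<noteq> {}" "\<Union>p \<subseteq> A" "t * ?m A < ?m (\<Union>p)"
        using box_family_inner_approx[OF A, of "t * ?m A"] t pos by auto
      obtain q where q: "box_family q" "q \<noteq> {}" "\<Union>q \<subseteq> B" "t * ?m B < ?m (\<Union>q)"
        using box_family_inner_approx[OF B, of "t * ?m B"] t pos by auto
      have "t * (?m A powr (1 - s) * ?m B powr s) = (t * ?m A) powr (1 - s) * (t * ?m B) powr s"
        using t pos by (simp add: powr_mult powr_diff field_simps)
      also have "\<dots> \<le> ?m (\<Union>p) powr (1 - s) * ?m (\<Union>q) powr s"
        using p q t pos s by (intro mult_mono powr_mono2) auto
      also have "\<dots> \<le> ?m M"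
        using brunn_minkowski_boxes[OF p(1) q(1) p(2) q(2)] s M
        by (rule brunn_minkowskiD) (use p q sub in blast)
      finally show "t * (?m A powr (1 - s) * ?m B powr s) \<le> ?m M" .
    qed
  qed auto
qed

section \<open>Gruenbaum's inequality\<close>

text \<open>Layer-cake formula: by Fubini the expectation is the integral over
  \<open>r \<ge> 0\<close> of the probability that \<open>f\<close> exceeds \<open>r\<close>, hence
  at most the integral of \<open>exp (- r)\<close>, which is 1.\<close>

lemma (in prob_space) exponential_tail_expectation:
  fixes f :: "'a \<Rightarrow> real"
  assumes f[measurable]: "f \<in> borel_measurable M" and nonneg: "\<And>x. x \<in> space M \<Longrightarrow> 0 \<le> f x"
    and tail: "\<And>r. 0 \<le> r \<Longrightarrow> prob {x \<in> space M. r < f x} \<le> exp (- r)"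
  shows "integrable M f" "expectation f \<le> 1"
proof -
  interpret pair_sigma_finite M lborel by unfold_locales
  have "(\<integral>\<^sup>+x. ennreal (f x) \<partial>M) = (\<integral>\<^sup>+x. (\<integral>\<^sup>+r. indicator {r. 0 \<le> r \<and> r < f x} r \<partial>lborel) \<partial>M)"
  proof (rule nn_integral_cong)
    fix x assume "x \<in> space M"
    then have "ennreal (f x) = emeasure lborel {0..<f x}" using nonneg by simp
    also have "{0..<f x} = {r. 0 \<le> r \<and> r < f x}" by auto
    finally show "ennreal (f x) = (\<integral>\<^sup>+r. indicator {r. 0 \<le> r \<and> r < f x} r \<partial>lborel)"
      by simp
  qed
  also have "\<dots> = (\<integral>\<^sup>+r. (\<integral>\<^sup>+x. indicator {r. 0 \<le> r \<and> r < f x} r \<partial>M) \<partial>lborel)"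
    by (rule Fubini'[symmetric]) measurable
  \<comment> \<open>The factor \<open>r ^ 0\<close> puts the integrand into the form of the
    factorial integral of \<open>r ^ k * exp (- r)\<close>.\<close>
  also have "\<dots> \<le> (\<integral>\<^sup>+r. ennreal (r ^ 0 * exp (- r)) * indicator {0..} r \<partial>lborel)"
  proof (rule nn_integral_mono)
    fix r :: real
    show "(\<integral>\<^sup>+x. indicator {r. 0 \<le> r \<and> r < f x} r \<partial>M) \<le> ennreal (r ^ 0 * exp (- r)) * indicator {0..} r"
    proof (cases "0 \<le> r")
      case True
      then have "(\<integral>\<^sup>+x. indicator {r. 0 \<le> r \<and> r < f x} r \<partial>M) = (\<integral>\<^sup>+x. indicator {x \<in> space M. r < f x} x \<partial>M)"
        by (intro nn_integral_cong) (auto simp: indicator_def)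
      also have "\<dots> = ennreal (prob {x \<in> space M. r < f x})"
        by (simp add: emeasure_eq_measure)
      finally show ?thesis using True tail[OF True] by (simp add: ennreal_leI)
    qed simp
  qed
  also have "\<dots> = 1" by (subst nn_intergal_power_times_exp_Ici) simp
  finally have le: "(\<integral>\<^sup>+x. ennreal (f x) \<partial>M) \<le> 1" .
  show int: "integrable M f"
    using le nonneg by (intro integrableI_nonneg) (auto intro: le_less_trans[OF le])
  have "ennreal (expectation f) \<le> 1"
    using le nn_integral_eq_integral[OF int] nonneg by simp
  then show "expectation f \<le> 1"
    by (metis ennreal_1 ennreal_le_iff zero_le_one)
qed

section \<open>Volumes of caps of a convex body\<close>

text \<open>The interior and the strict inequality make the cap open, as
  \<open>brunn_minkowski_open\<close> requires; \<open>halfspace_tail_eq\<close> passes to the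
  closed cap.\<close>

definition halfspace_tail :: "'a::euclidean_space set \<Rightarrow> 'a \<Rightarrow> real \<Rightarrow> real" where
  "halfspace_tail C a t = measure lebesgue (interior C \<inter> {x. t < a \<bullet> x})"

lemma convex_body_lmeasurable:
  assumes "convex_body C"
  shows "C \<in> lmeasurable" "interior C \<in> lmeasurable"
  using assms by (auto simp: convex_body_def lmeasurable_compact lmeasurable_interior compact_imp_bounded)

lemma convex_body_measure_pos:
  fixes C :: "'a::euclidean_space set"
  assumes "convex_body C"
  shows "0 < measure lebesgue C"
proof -
  have "\<not> negligible C"
    using assms open_not_negligible[OF open_interior, of C] negligible_subset[OF _ interior_subset] by (auto simp: convex_body_def)
  then show ?thesis
    using convex_body_lmeasurable[OF assms] by (simp add: negligible_iff_measure zero_less_measure_iff)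
qed

lemma halfspace_tail_lmeasurable:
  fixes C :: "'a::euclidean_space set"
  assumes "convex_body C"
  shows "interior C \<inter> {x. t < a \<bullet> x} \<in> lmeasurable"
  by (rule fmeasurable_Int_fmeasurable[OF convex_body_lmeasurable(2)[OF assms]])
     (simp add: borel_open open_halfspace_gt)

lemma halfspace_tail_antimono:
  fixes C :: "'a::euclidean_space set"
  assumes "convex_body C" "t \<le> u"
  shows "halfspace_tail C a u \<le> halfspace_tail C a t"
  unfolding halfspace_tail_def using assms
  by (intro measure_mono_fmeasurable halfspace_tail_lmeasurable fmeasurableD) auto

text \<open>The open and closed caps differ only inside the frontier of \<open>C\<close>, negligible
  by convexity, and a hyperplane.\<close>

lemma halfspace_tail_eq:
  fixes C :: "'a::euclidean_space set"
  assumes C: "convex_body C" and a: "a \<noteq> 0"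
  shows "halfspace_tail C a t = measure lebesgue (C \<inter> {x. t \<le> a \<bullet> x})"
  unfolding halfspace_tail_def
proof (rule measure_negligible_symdiff)
  show "C \<inter> {x. t \<le> a \<bullet> x} \<in> lmeasurable"
    using convex_body_lmeasurable(1)[OF C] by (rule lmeasurable_halfspace_ge)
  have "convex C" "closed C" using C by (auto simp: convex_body_def compact_imp_closed)
  have "negligible (frontier C \<union> {x. a \<bullet> x = t})"
    using negligible_convex_frontier[OF \<open>convex C\<close>] negligible_hyperplane[of a t] a by simp
  then show "negligible (C \<inter> {x. t \<le> a \<bullet> x} - interior C \<inter> {x. t < a \<bullet> x} \<union>
      (interior C \<inter> {x. t < a \<bullet> x} - C \<inter> {x. t \<le> a \<bullet> x}))"
    by (rule negligible_subset)
       (use interior_subset[of C] closure_subset[of C] in \<open>auto simp: frontier_def\<close>)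
qed

text \<open>A convex body is contained in the closure of its interior, so the open halfspace around
  \<open>w\<close> meets the interior in a nonempty open set.\<close>

lemma halfspace_tail_pos:
  fixes C :: "'a::euclidean_space set"
  assumes C: "convex_body C" and w: "w \<in> C" and t: "t < a \<bullet> w"
  shows "0 < halfspace_tail C a t"
proof -
  let ?H = "{x. t < a \<bullet> x}"
  have "w \<in> closure (interior C)"
    using C w closure_subset convex_closure_interior by (fastforce simp: convex_body_def)
  then have "interior C \<inter> ?H \<noteq> {}"
    using t open_Int_closure_eq_empty[OF open_halfspace_gt[of t a], of "interior C"] by blast
  moreover have "open (interior C \<inter> ?H)" by (intro open_Int open_halfspace_gt open_interior)
  ultimately have "\<not> negligible (interior C \<inter> ?H)" using open_not_negligible by blast
  then show ?thesis
    unfolding halfspace_tail_def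
    using halfspace_tail_lmeasurable[OF C] by (simp add: negligible_iff_measure zero_less_measure_iff)
qed

text \<open>By convexity, combinations of points of the caps at \<open>t\<close> and
  \<open>u\<close> lie in the cap at the intermediate level, so Brunn-Minkowski applies to these
  caps.\<close>

lemma halfspace_tail_log_concave:
  fixes C :: "'a::euclidean_space set"
  assumes C: "convex_body C" and s: "0 < s" "s < 1"
  shows "halfspace_tail C a t powr (1 - s) * halfspace_tail C a u powr s
    \<le> halfspace_tail C a ((1 - s) * t + s * u)"
  unfolding halfspace_tail_def
proof (rule brunn_minkowskiD[OF brunn_minkowski_open s])
  fix x y assume xy: "x \<in> interior C \<inter> {x. t < a \<bullet> x}" "y \<in> interior C \<inter> {x. u < a \<bullet> x}"
  have "convex (interior C)" using C by (simp add: convex_body_def convex_interior)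
  then have "(1 - s) *\<^sub>R x + s *\<^sub>R y \<in> interior C"
    using xy s by (auto simp: convex_alt)
  moreover have "(1 - s) * t + s * u < (1 - s) * (a \<bullet> x) + s * (a \<bullet> y)"
    using xy s by (intro add_strict_mono mult_strict_left_mono) auto
  ultimately show "(1 - s) *\<^sub>R x + s *\<^sub>R y \<in> interior C \<inter> {x. (1 - s) * t + s * u < a \<bullet> x}"
    by (simp add: inner_add_right)
qed (use halfspace_tail_lmeasurable[OF C] in \<open>auto intro!: open_Int open_halfspace_gt\<close>)

text \<open>For \<open>X\<close> uniform on \<open>C\<close>, this is the bound \<open>P(F(a \<bullet> X) < u) \<le> u\<close>, scaled by the volume of \<open>C\<close>.\<close>

lemma halfspace_tail_uniform:
  fixes C :: "'a::euclidean_space set"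
  assumes C: "convex_body C" and a: "a \<noteq> 0" and u: "0 \<le> u" "u \<le> measure lebesgue C"
    and S: "S \<in> lmeasurable" "S \<subseteq> {x \<in> C. halfspace_tail C a (a \<bullet> x) < u}"
  shows "measure lebesgue S \<le> u"
proof -
  let ?V = "measure lebesgue C"
  have V: "0 < ?V" by (rule convex_body_measure_pos[OF C])
  note lm = convex_body_lmeasurable(1)[OF C]
  \<comment> \<open>\<open>c\<close> is the level above which \<open>C\<close> has volume exactly
    \<open>u\<close>. Since the tail is antitone, a tail smaller than \<open>u\<close> forces a
    level of at least \<open>c\<close>.\<close>
  obtain c where c: "measure lebesgue (C \<inter> {x. a \<bullet> x \<le> c}) = (1 - u / ?V) * ?V"
    using halfspace_prescribed_measure[OF lm _ a, of "1 - u / ?V"] C u V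
    by (auto simp: convex_body_def compact_imp_bounded)
  also have "\<dots> = ?V - u" using V by (simp add: field_simps)
  finally have u_eq: "measure lebesgue (C \<inter> {x. c \<le> a \<bullet> x}) = u"
    using measure_halfspace_split[OF lm a, of c] by simp
  have "S \<subseteq> C \<inter> {x. c \<le> a \<bullet> x}"
  proof
    fix x assume "x \<in> S"
    then have x: "x \<in> C" "halfspace_tail C a (a \<bullet> x) < halfspace_tail C a c"
      using S(2) u_eq halfspace_tail_eq[OF C a] by auto
    then have "c \<le> a \<bullet> x" using halfspace_tail_antimono[OF C, of "a \<bullet> x" c a] by linarith
    with x show "x \<in> C \<inter> {x. c \<le> a \<bullet> x}" by simp
  qed
  then show ?thesis
    unfolding u_eq[symmetric]
    using S(1) lmeasurable_halfspace_ge[OF lm] by (intro measure_mono_fmeasurable) auto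
qed

section \<open>The centroid and the caps through it\<close>

text \<open>Written as the mean of the uniform distribution so that Jensen's inequality applies
  directly.\<close>

definition centroid :: "'a::euclidean_space set \<Rightarrow> 'a" where
  "centroid C = (\<integral>x. x \<partial>uniform_measure lborel C)"

theorem grunbaum_inequality:
  fixes C :: "'a::euclidean_space set"
  assumes C: "convex_body C"
  shows "measure lebesgue C / exp 1 \<le> measure lebesgue (C \<inter> {x. a \<bullet> centroid C \<le> a \<bullet> x})"
proof (cases "a = 0")
  case True
  have "1 \<le> exp (1 :: real)" by simp
  then have "measure lebesgue C / exp 1 \<le> measure lebesgue C / 1"
    by (intro divide_left_mono) auto
  then show ?thesis using True by simp
next
  case a: False
  let ?V = "measure lebesgue C"
  let ?F = "halfspace_tail C a"
  have V: "0 < ?V" by (rule convex_body_measure_pos[OF C])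
  have compact: "compact C" and "C \<noteq> {}"
    using C by (auto simp: convex_body_def)
  have borel: "C \<in> sets borel" using compact by (simp add: borel_compact)
  have em: "emeasure lborel C = ennreal ?V"
    using emeasure_compact_finite[OF compact] borel
    by (subst emeasure_eq_ennreal_measure) (auto simp: measure_completion)
  define M where "M = uniform_measure lborel C"
  have [measurable_cong]: "sets M = sets borel" by (simp add: M_def)
  have space: "space M = UNIV" by (simp add: M_def)
  interpret prob_space M
    unfolding M_def by (rule prob_space_uniform_measure) (use V in \<open>simp_all add: em ennreal_eq_0_iff\<close>)
  have AE_C: "AE x in M. x \<in> C"
    unfolding M_def by (rule AE_uniform_measureI) (use borel in auto)
  have prob: "prob S = measure lebesgue (C \<inter> S) / ?V" if "S \<in> sets borel" for S
    unfolding M_def using that em V borel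
    by (subst measure_uniform_measure) (auto simp: measure_completion)
  have "continuous_on C (\<lambda>x. a \<bullet> x)" by (intro continuous_intros)
  then obtain w where w: "w \<in> C" "\<And>x. x \<in> C \<Longrightarrow> a \<bullet> x \<le> a \<bullet> w"
    using continuous_attains_sup[OF compact \<open>C \<noteq> {}\<close>] by blast
  define b where "b = a \<bullet> w"
  obtain B where B: "\<And>x. x \<in> C \<Longrightarrow> norm x \<le> B"
    using bounded_iff[THEN iffD1, OF compact_imp_bounded[OF compact]] by blast
  have int_id: "integrable M (\<lambda>x. x)"
    using AE_C by (intro integrable_const_bound[of _ B]) (auto elim!: eventually_mono intro: B)
  then have int: "integrable M (\<lambda>x. a \<bullet> x)" by simp
  have mean: "expectation (\<lambda>x. a \<bullet> x) = a \<bullet> centroid C"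
    using int_id by (simp add: centroid_def M_def)
  have "AE x in lborel. a \<bullet> x \<noteq> b"
    using negligible_hyperplane[of a b] a
    by (intro AE_I'[of "{x. a \<bullet> x = b}"])
       (auto simp: negligible_iff_null_sets null_sets_completion_iff borel_closed closed_hyperplane)
  then have AE_less: "AE x in M. a \<bullet> x \<in> {..<b}"
    unfolding M_def
    by (intro AE_uniform_measureI) (use borel w(2) in \<open>auto simp: b_def less_le elim!: eventually_mono\<close>)
  \<comment> \<open>The supporting hyperplane at the maximum \<open>b\<close> is null, so almost
    surely \<open>a \<bullet> x < b\<close> and the mean is strictly below \<open>b\<close>. Hence
    the tail at the centroid is positive and its logarithm is genuine.\<close>
  then have mean_less: "a \<bullet> centroid C < b"
    using expectation_less[OF int, of b] by (simp add: mean)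
  have F_pos: "0 < ?F t" if "t < b" for t
    using halfspace_tail_pos[OF C w(1)] that by (simp add: b_def)
  have F_nonneg: "0 \<le> ?F t" for t by (simp add: halfspace_tail_def)
  have F_le: "?F t \<le> ?V" for t
    unfolding halfspace_tail_eq[OF C a]
    using convex_body_lmeasurable(1)[OF C] lmeasurable_halfspace_ge
    by (intro measure_mono_fmeasurable fmeasurableD) auto
  \<comment> \<open>For \<open>t \<ge> b\<close> the tail is 0 and \<open>ln 0 = 0\<close> makes
    \<open>q t = 0\<close>. Convexity is therefore claimed only on \<open>{..<b}\<close>, where the
    values lie almost surely.\<close>
  define q where "q t = - ln (?F t / ?V)" for t
  have q_nonneg: "0 \<le> q t" for t
  proof (cases "?F t = 0")
    case False
    then have "0 < ?F t" using F_nonneg[of t] by simp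
    then show ?thesis using V F_le[of t] by (simp add: q_def ln_le_zero_iff)
  qed (simp add: q_def)
  have "convex_on {..<b} q"
  proof (rule convex_onI)
    fix s t u :: real assume s: "0 < s" "s < 1" and tu: "t \<in> {..<b}" "u \<in> {..<b}"
    let ?r = "(1 - s) * t + s * u"
    have "?r < (1 - s) * b + s * b"
      using s tu by (intro add_strict_mono mult_strict_left_mono) auto
    then have r: "?r < b" by (simp add: algebra_simps)
    have pos: "0 < ?F t" "0 < ?F u" "0 < ?F ?r" using tu r F_pos by auto
    have "(1 - s) * ln (?F t) + s * ln (?F u) = ln (?F t powr (1 - s) * ?F u powr s)"
      using pos by (simp add: ln_mult ln_powr)
    also have "\<dots> \<le> ln (?F ?r)"
      using halfspace_tail_log_concave[OF C s, of a t u] pos by simp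
    finally show "q ((1 - s) *\<^sub>R t + s *\<^sub>R u) \<le> (1 - s) * q t + s * q u"
      using pos V by (simp add: q_def ln_div algebra_simps)
  qed simp
  moreover have q_meas: "q \<in> borel_measurable borel"
  proof -
    have "mono (\<lambda>t. - ?F t)" using halfspace_tail_antimono[OF C] by (simp add: mono_def)
    then have "(\<lambda>t. - (- ?F t)) \<in> borel_measurable borel"
      by (intro borel_measurable_uminus borel_measurable_mono)
    then have [measurable]: "?F \<in> borel_measurable borel" by simp
    show ?thesis unfolding q_def by measurable
  qed
  moreover have tail: "prob {x \<in> space M. r < q (a \<bullet> x)} \<le> exp (- r)" if r: "0 \<le> r" for r
  proof -
    let ?S = "{x. r < q (a \<bullet> x)}"
    have [measurable]: "q \<in> borel_measurable borel" by (rule q_meas)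
    have S: "?S \<in> sets borel" by measurable
    \<comment> \<open>\<open>r < q t\<close> implies that the tail at \<open>t\<close> is below
      \<open>?V * exp (- r)\<close>, also where the tail vanishes; so
      \<open>halfspace_tail_uniform\<close> applies with this value as \<open>u\<close>.\<close>
    have "measure lebesgue (C \<inter> ?S) \<le> ?V * exp (- r)"
    proof (rule halfspace_tail_uniform[OF C a])
      have "?V * exp (- r) \<le> ?V * 1" using V r by (intro mult_left_mono) auto
      then show "?V * exp (- r) \<le> ?V" by simp
      show "C \<inter> ?S \<in> lmeasurable"
        using convex_body_lmeasurable(1)[OF C] S by (intro fmeasurable_Int_fmeasurable) auto
      show "C \<inter> ?S \<subseteq> {x \<in> C. ?F (a \<bullet> x) < ?V * exp (- r)}"
      proof safe
        fix x assume rq: "r < q (a \<bullet> x)"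
        show "?F (a \<bullet> x) < ?V * exp (- r)"
        proof (cases "?F (a \<bullet> x) = 0")
          case False
          then have "0 < ?F (a \<bullet> x)" using F_nonneg[of "a \<bullet> x"] by simp
          then have "0 < ?F (a \<bullet> x) / ?V" using V by simp
          moreover have "exp (ln (?F (a \<bullet> x) / ?V)) < exp (- r)"
            using rq by (simp add: q_def)
          ultimately have "?F (a \<bullet> x) / ?V < exp (- r)" by simp
          then show ?thesis using V by (simp add: field_simps)
        qed (use V in simp)
      qed
    qed (use V in simp)
    then have "measure lebesgue (C \<inter> ?S) / ?V \<le> exp (- r)"
      using V by (simp add: divide_le_eq mult.commute)
    then show ?thesis by (simp add: prob[OF S] space)
  qed
  ultimately have "q (a \<bullet> centroid C) \<le> 1"
  proof -
    assume conv: "convex_on {..<b} q" and [measurable]: "q \<in> borel_measurable borel"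
    have *: "integrable M (\<lambda>x. q (a \<bullet> x))" "expectation (\<lambda>x. q (a \<bullet> x)) \<le> 1"
      using q_nonneg tail by (auto intro!: exponential_tail_expectation)
    have "q (expectation (\<lambda>x. a \<bullet> x)) \<le> expectation (\<lambda>x. q (a \<bullet> x))"
      by (rule jensens_inequality[OF int AE_less _ *(1) conv]) blast
    then show ?thesis using * mean by simp
  qed
  then have "- 1 \<le> ln (?F (a \<bullet> centroid C) / ?V)" by (simp add: q_def)
  then have "exp (- 1) \<le> ?F (a \<bullet> centroid C) / ?V"
    using F_pos[OF mean_less] V by (metis divide_pos_pos exp_le_cancel_iff exp_ln)
  then have "?V / exp 1 \<le> ?F (a \<bullet> centroid C)"
    using V by (simp add: exp_minus field_simps)
  then show ?thesis by (simp add: halfspace_tail_eq[OF C a])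
qed

text \<open>If a hyperplane strictly separated the centroid from \<open>C\<close>, one of the two
  halfspaces bounded by its parallel through the centroid would miss \<open>C\<close>, contradicting
  Gruenbaum's lower bound for that cap.\<close>

lemma centroid_in_convex_body:
  fixes C :: "'a::euclidean_space set"
  assumes C: "convex_body C"
  shows "centroid C \<in> C"
proof (rule ccontr)
  assume "centroid C \<notin> C"
  then obtain a b where "a \<bullet> centroid C < b" "\<forall>x\<in>C. b < a \<bullet> x"
    using C separating_hyperplane_closed_point[of C "centroid C"]
    by (auto simp: convex_body_def compact_imp_closed)
  then have "C \<inter> {x. (- a) \<bullet> centroid C \<le> (- a) \<bullet> x} = {}" by force
  then have "measure lebesgue C / exp 1 \<le> 0"
    using grunbaum_inequality[OF C, of "- a"] by (metis measure_empty)
  then show False using convex_body_measure_pos[OF C] by (simp add: divide_le_0_iff)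
qed

section \<open>Mixed-integer volume\<close>

definition nearest :: "real ^ 'n \<Rightarrow> real ^ 'n" where
  "nearest z = (\<chi> i. of_int (round (z $ i)))"

lemma nearest_in_integer_points: "nearest z \<in> integer_points"
  by (simp add: nearest_def integer_points_def)

lemma nearest_close: "\<bar>(nearest z - z) $ i\<bar> \<le> 1 / 2"
  using of_int_round_abs_le[of "z $ i"] by (simp add: nearest_def)

lemma measurable_nearest: "(nearest :: real ^ 'n \<Rightarrow> _) \<in> borel_measurable borel"
proof -
  have [measurable]: "(\<lambda>z :: real ^ 'n. z $ i) \<in> borel_measurable borel" for i
    by (intro borel_measurable_continuous_onI continuous_intros)
  have "(\<lambda>z :: real ^ 'n. real_of_int \<lfloor>z $ i + 1 / 2\<rfloor>) \<in> borel_measurable borel" for i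
    by measurable
  then have "(\<lambda>z :: real ^ 'n. nearest z \<bullet> b) \<in> borel_measurable borel" if "b \<in> Basis" for b
    using that by (auto simp: Basis_vec_def nearest_def round_def inner_axis)
  then show ?thesis using borel_measurable_euclidean_space[of nearest borel] by blast
qed

text \<open>The cell lies between the open and the closed unit cube centred at \<open>z\<close>,
  which have the same volume, so the rounding of ties does not matter.\<close>

lemma emeasure_nearest_cell:
  fixes z :: "real ^ 'n"
  assumes "z \<in> integer_points"
  shows "emeasure lborel {z'. nearest z' = z} = 1"
proof (rule antisym)
  define h :: "real ^ 'n" where "h = (\<chi> i. 1 / 2)"
  have h: "h \<bullet> b = 1 / 2" if "b \<in> Basis" for b
    using that by (auto simp: Basis_vec_def h_def inner_axis)
  have "z + h - (z - h) = 2 *\<^sub>R h" by (simp add: scaleR_2)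
  then have prod: "(\<Prod>b\<in>Basis. (z + h - (z - h)) \<bullet> b) = 1"
    by (simp add: h)
  have le: "(z - h) \<bullet> b \<le> (z + h) \<bullet> b" if "b \<in> Basis" for b
    using h[OF that] by (simp add: inner_add_left inner_diff_left)
  have meas: "{z'. nearest z' = z} \<in> sets lborel"
    using measurable_sets[OF measurable_nearest, of "{z}"] by (simp add: vimage_def)
  have "{z'. nearest z' = z} \<subseteq> cbox (z - h) (z + h)"
  proof
    fix z' assume "z' \<in> {z'. nearest z' = z}"
    then have "\<bar>z $ i - z' $ i\<bar> \<le> 1 / 2" for i using nearest_close[of z' i] by simp
    then have "z $ i - 1 / 2 \<le> z' $ i \<and> z' $ i \<le> z $ i + 1 / 2" for i by (smt (verit))
    then show "z' \<in> cbox (z - h) (z + h)" by (simp add: mem_box_cart h_def)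
  qed
  then have "emeasure lborel {z'. nearest z' = z} \<le> emeasure lborel (cbox (z - h) (z + h))"
    by (intro emeasure_mono) auto
  also have "\<dots> = 1" using le by (subst emeasure_lborel_cbox) (simp_all only: prod ennreal_1)
  finally show "emeasure lborel {z'. nearest z' = z} \<le> 1" .
  have "box (z - h) (z + h) \<subseteq> {z'. nearest z' = z}"
  proof
    fix z' assume z': "z' \<in> box (z - h) (z + h)"
    have "of_int (round (z' $ i)) = z $ i" for i
    proof -
      obtain m where m: "z $ i = of_int m" using assms by (auto simp: integer_points_def Ints_def)
      have "of_int m - 1 / 2 < z' $ i" "z' $ i < of_int m + 1 / 2"
        using z'[unfolded mem_box_cart, THEN spec, of i] m by (auto simp: h_def)
      then have "round (z' $ i) = m" by (intro round_unique') (auto simp: abs_if)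
      then show ?thesis by (simp add: m)
    qed
    then show "z' \<in> {z'. nearest z' = z}" by (simp add: nearest_def vec_eq_iff)
  qed
  then have "emeasure lborel (box (z - h) (z + h)) \<le> emeasure lborel {z'. nearest z' = z}"
    using meas by (rule emeasure_mono)
  then show "1 \<le> emeasure lborel {z'. nearest z' = z}"
    using le by (subst (asm) emeasure_lborel_box) (simp_all only: prod ennreal_1)
qed

lemma finite_integer_points_bounded:
  fixes K :: "(real ^ 'n) set"
  assumes "bounded K"
  shows "finite (integer_points \<inter> K)"
proof -
  obtain B where B: "\<And>z. z \<in> K \<Longrightarrow> norm z \<le> B"
    using assms by (auto simp: bounded_iff)
  have "integer_points \<inter> K \<subseteq> (\<lambda>f. \<chi> i. of_int (f i)) ` (UNIV \<rightarrow>\<^sub>E {-\<lceil>B\<rceil>..\<lceil>B\<rceil>})"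
  proof
    fix z assume z: "z \<in> integer_points \<inter> K"
    define f where "f i = \<lfloor>z $ i\<rfloor>" for i
    have f: "z $ i = of_int (f i)" for i using z by (auto simp: integer_points_def f_def Ints_def)
    have "f i \<in> {-\<lceil>B\<rceil>..\<lceil>B\<rceil>}" for i
    proof -
      have "\<bar>of_int (f i)\<bar> \<le> B"
        using component_le_norm_cart[of z i] B[of z] z f[of i] by simp
      then have "\<bar>f i\<bar> \<le> \<lceil>B\<rceil>" by linarith
      then show ?thesis by auto
    qed
    moreover have "z = (\<chi> i. of_int (f i))" by (simp add: vec_eq_iff f)
    ultimately show "z \<in> (\<lambda>f. \<chi> i. of_int (f i)) ` (UNIV \<rightarrow>\<^sub>E {-\<lceil>B\<rceil>..\<lceil>B\<rceil>})"
      by (intro image_eqI[of _ _ f]) (auto simp: PiE_UNIV_domain)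
  qed
  moreover have "finite (UNIV \<rightarrow>\<^sub>E {-\<lceil>B\<rceil>..\<lceil>B\<rceil>} :: ('n \<Rightarrow> int) set)"
    by (intro finite_PiE) auto
  ultimately show ?thesis using finite_surj by blast
qed

section \<open>The mixed-integer volume as a finite sum and as an integral\<close>

lemma mi_volume_eq_sum:
  fixes A :: "((real ^ 'n) \<times> (real ^ 'd)) set"
  assumes "finite J" "J \<subseteq> integer_points" "fst ` A \<inter> integer_points \<subseteq> J"
  shows "mi_volume A = (\<Sum>z\<in>J. emeasure lebesgue {x. (z, x) \<in> A})"
proof -
  have "mi_volume A = (\<Sum>\<^sub>\<infinity>z\<in>J. emeasure lebesgue {x. (z, x) \<in> A})"
    unfolding mi_volume_def
  proof (rule infsum_cong_neutral)
    fix z :: "real ^ 'n" assume "z \<in> integer_points - J"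
    then have "{x. (z, x) \<in> A} = {}" using assms(3) by force
    then show "emeasure lebesgue {x. (z, x) \<in> A} = 0" by (simp only: emeasure_empty)
  qed (use assms(2) in auto)
  then show ?thesis using assms(1) by (simp only: infsum_finite)
qed

text \<open>Each fibre volume is spread over the rounding cell of its integer point, which has
  volume 1. The result can be compared fibre by fibre with Lebesgue measure written by
  Fubini.\<close>

lemma mi_volume_eq_nn_integral:
  fixes A :: "((real ^ 'n) \<times> (real ^ 'd)) set"
  assumes "bounded (fst ` A)"
  shows "mi_volume A = (\<integral>\<^sup>+z. emeasure lebesgue {x. (nearest z, x) \<in> A} \<partial>lborel)"
proof -
  define g where "g z = emeasure lebesgue {x. (z, x) \<in> A}" for z
  define J where "J = integer_points \<inter> fst ` A"
  have J: "finite J" "J \<subseteq> integer_points" "fst ` A \<inter> integer_points \<subseteq> J"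
    using finite_integer_points_bounded[OF assms] by (auto simp: J_def)
  have meas[measurable]: "{z'. nearest z' = z} \<in> sets borel" for z :: "real ^ 'n"
    using measurable_sets[OF measurable_nearest, of "{z}"] by (simp add: vimage_def)
  have "g (nearest z) = (\<Sum>j\<in>J. g j * indicator {z'. nearest z' = j} z)" for z
  proof (cases "nearest z \<in> J")
    case True
    then show ?thesis
      using J(1) by (simp add: indicator_def sum.delta if_distrib cong: if_cong)
  next
    case False
    then have "{x. (nearest z, x) \<in> A} = {}"
      using nearest_in_integer_points[of z] by (force simp: J_def)
    then have "g (nearest z) = 0" by (simp only: g_def emeasure_empty)
    moreover have "(\<Sum>j\<in>J. g j * indicator {z'. nearest z' = j} z) = 0"
      using False by (intro sum.neutral) (auto simp: indicator_def)
    ultimately show ?thesis by simp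
  qed
  then have "(\<integral>\<^sup>+z. g (nearest z) \<partial>lborel) = (\<integral>\<^sup>+z. (\<Sum>j\<in>J. g j * indicator {z'. nearest z' = j} z) \<partial>lborel)"
    by simp
  also have "\<dots> = (\<Sum>j\<in>J. \<integral>\<^sup>+z. g j * indicator {z'. nearest z' = j} z \<partial>lborel)"
    by (rule nn_integral_sum) measurable
  also have "\<dots> = (\<Sum>j\<in>J. g j)"
  proof (rule sum.cong[OF refl])
    fix j assume "j \<in> J"
    then have "emeasure lborel {z'. nearest z' = j} = 1" using J(2) by (intro emeasure_nearest_cell) auto
    then show "(\<integral>\<^sup>+z. g j * indicator {z'. nearest z' = j} z \<partial>lborel) = g j"
      using meas[of j] by (subst nn_integral_cmult_indicator) auto
  qed
  also have "\<dots> = mi_volume A" using mi_volume_eq_sum[OF J] by (simp only: g_def)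
  finally show ?thesis by (simp only: g_def)
qed

text \<open>Fubini combined with translation invariance in the first factor. The shift
  \<open>c\<close> absorbs the offset of the cube centre in the comparisons below.\<close>

lemma emeasure_prod_shifted:
  fixes A :: "((real ^ 'n) \<times> (real ^ 'd)) set"
  assumes "A \<in> sets borel"
  shows "emeasure lborel A = (\<integral>\<^sup>+z. emeasure lborel {x. (z + c, x) \<in> A} \<partial>lborel)"
proof -
  have A: "A \<in> sets (lborel \<Otimes>\<^sub>M lborel)" using assms by (subst lborel_prod) simp
  have "emeasure lborel A = emeasure (lborel \<Otimes>\<^sub>M lborel) A" by (simp add: lborel_prod)
  also have "\<dots> = (\<integral>\<^sup>+z. emeasure lborel (Pair z -` A) \<partial>lborel)"
    by (rule lborel.emeasure_pair_measure_alt[OF A])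
  also have "\<dots> = (\<integral>\<^sup>+z. emeasure lborel (Pair z -` A) \<partial>distr lborel borel ((+) c))"
    by (simp add: lborel_distr_plus)
  also have "\<dots> = (\<integral>\<^sup>+z. emeasure lborel (Pair (c + z) -` A) \<partial>lborel)"
    using lborel.measurable_emeasure_Pair[OF A] by (intro nn_integral_distr) auto
  finally show ?thesis by (simp add: vimage_def add.commute)
qed

lemma emeasure_lebesgue_translate_le:
  fixes A B :: "'a::euclidean_space set"
  assumes "\<And>x. x \<in> A \<Longrightarrow> x + d \<in> B" "B \<in> sets lebesgue"
  shows "emeasure lebesgue A \<le> emeasure lebesgue B"
proof -
  have "emeasure lebesgue A = emeasure lebesgue ((\<lambda>x. 1 *\<^sub>R x + d) ` A)"
    unfolding emeasure_lebesgue_affine by simp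
  also have "\<dots> \<le> emeasure lebesgue B"
    using assms by (intro emeasure_mono) auto
  finally show ?thesis .
qed

lemma fibre_in_sets_borel:
  fixes A :: "((real ^ 'n) \<times> (real ^ 'd)) set"
  assumes "A \<in> sets borel"
  shows "{x. (z, x) \<in> A} \<in> sets borel"
proof -
  have "Pair z \<in> borel_measurable borel" by (intro borel_measurable_continuous_onI continuous_intros)
  from measurable_sets[OF this assms] show ?thesis by (simp add: vimage_def)
qed

section \<open>Order, additivity and limits of the mixed-integer volume\<close>

lemma closed_integer_points: "closed (integer_points :: (real ^ 'n) set)"
proof -
  have eq: "integer_points = (\<Inter>i. (\<lambda>z :: real ^ 'n. z $ i) -` \<int>)"
    by (auto simp: integer_points_def)
  show ?thesis
    unfolding eq by (intro closed_INT ballI closed_vimage closed_Ints continuous_intros)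
qed

lemma compact_mixed_integer:
  fixes C :: "((real ^ 'n) \<times> (real ^ 'd)) set"
  assumes "compact C"
  shows "compact (C \<inter> (integer_points \<times> UNIV))"
  using assms by (intro compact_Int_closed closed_Times closed_integer_points) auto

lemma bounded_fst_image:
  fixes A :: "('a::real_normed_vector \<times> 'b::real_normed_vector) set"
  shows "bounded A \<Longrightarrow> bounded (fst ` A)"
  by (rule bounded_linear_image[OF _ bounded_linear_fst])

lemma mi_volume_mono:
  fixes A B :: "((real ^ 'n) \<times> (real ^ 'd)) set"
  assumes sub: "A \<subseteq> B" and B: "bounded B" "B \<in> sets borel"
  shows "mi_volume A \<le> mi_volume B"
proof -
  let ?J = "integer_points \<inter> fst ` B"
  have J: "finite ?J" by (intro finite_integer_points_bounded bounded_fst_image B)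
  have "mi_volume A = (\<Sum>z\<in>?J. emeasure lebesgue {x. (z, x) \<in> A})"
    using sub by (intro mi_volume_eq_sum[OF J]) auto
  also have "\<dots> \<le> (\<Sum>z\<in>?J. emeasure lebesgue {x. (z, x) \<in> B})"
    using sub fibre_in_sets_borel[OF B(2)] by (intro sum_mono emeasure_mono) auto
  also have "\<dots> = mi_volume B"
    by (rule mi_volume_eq_sum[OF J, symmetric]) auto
  finally show ?thesis .
qed

lemma mi_volume_Un_disjoint:
  fixes A B :: "((real ^ 'n) \<times> (real ^ 'd)) set"
  assumes A: "bounded A" "A \<in> sets borel" and B: "bounded B" "B \<in> sets borel" and disj: "A \<inter> B = {}"
  shows "mi_volume (A \<union> B) = mi_volume A + mi_volume B"
proof -
  let ?J = "integer_points \<inter> fst ` (A \<union> B)"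
  have J: "finite ?J" using A B by (intro finite_integer_points_bounded bounded_fst_image) auto
  have eq: "mi_volume D = (\<Sum>z\<in>?J. emeasure lebesgue {x. (z, x) \<in> D})" if "D \<subseteq> A \<union> B" for D
    using that by (intro mi_volume_eq_sum[OF J]) auto
  have "emeasure lebesgue {x. (z, x) \<in> A \<union> B} =
      emeasure lebesgue {x. (z, x) \<in> A} + emeasure lebesgue {x. (z, x) \<in> B}" for z
  proof -
    have "{x. (z, x) \<in> A} \<inter> {x. (z, x) \<in> B} = {}" using disj by auto
    moreover have "{x. (z, x) \<in> A \<union> B} = {x. (z, x) \<in> A} \<union> {x. (z, x) \<in> B}" by auto
    ultimately show ?thesis
      using fibre_in_sets_borel[OF A(2), of z] fibre_in_sets_borel[OF B(2), of z]
      by (simp only: ) (intro plus_emeasure[symmetric]; simp)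
  qed
  then show ?thesis by (simp only: eq[of "A \<union> B"] eq[of A] eq[of B] Un_upper1 Un_upper2 subset_refl sum.distrib)
qed

text \<open>Only finitely many fibres matter, and each is bounded and so of finite measure;
  continuity from above holds fibrewise and passes to the finite sum.\<close>

lemma mi_volume_decseq:
  fixes A :: "nat \<Rightarrow> ((real ^ 'n) \<times> (real ^ 'd)) set"
  assumes "decseq A" and A: "\<And>n. bounded (A n)" "\<And>n. A n \<in> sets borel"
  shows "(\<lambda>n. mi_volume (A n)) \<longlonglongrightarrow> mi_volume (\<Inter>n. A n)"
proof -
  let ?J = "integer_points \<inter> fst ` A 0"
  have J: "finite ?J" by (intro finite_integer_points_bounded bounded_fst_image A)
  have sub: "A n \<subseteq> A 0" for n using \<open>decseq A\<close> by (auto simp: decseq_def)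
  have eq: "mi_volume D = (\<Sum>z\<in>?J. emeasure lebesgue {x. (z, x) \<in> D})" if "D \<subseteq> A 0" for D
    using that by (intro mi_volume_eq_sum[OF J]) auto
  have lim: "(\<lambda>n. emeasure lebesgue {x. (z, x) \<in> A n}) \<longlonglongrightarrow> emeasure lebesgue {x. (z, x) \<in> (\<Inter>n. A n)}" for z
  proof -
    have "(\<lambda>n. emeasure lebesgue {x. (z, x) \<in> A n}) \<longlonglongrightarrow> emeasure lebesgue (\<Inter>n. {x. (z, x) \<in> A n})"
    proof (rule Lim_emeasure_decseq)
      show "range (\<lambda>n. {x. (z, x) \<in> A n}) \<subseteq> sets lebesgue"
        using fibre_in_sets_borel[OF A(2)] by auto
      show "decseq (\<lambda>n. {x. (z, x) \<in> A n})" using \<open>decseq A\<close> by (auto simp: decseq_def)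
      fix n
      have "bounded (snd ` A n)" by (rule bounded_linear_image[OF A(1) bounded_linear_snd])
      moreover have "{x. (z, x) \<in> A n} \<subseteq> snd ` A n" by (auto intro: image_eqI[of _ snd "(z, _)"])
      ultimately have "bounded {x. (z, x) \<in> A n}" by (rule bounded_subset)
      then have "{x. (z, x) \<in> A n} \<in> lmeasurable"
        using fibre_in_sets_borel[OF A(2)] by (intro bounded_set_imp_lmeasurable) auto
      then show "emeasure lebesgue {x. (z, x) \<in> A n} \<noteq> \<infinity>"
        using fmeasurableD2 by (metis infinity_ennreal_def)
    qed
    moreover have "(\<Inter>n. {x. (z, x) \<in> A n}) = {x. (z, x) \<in> (\<Inter>n. A n)}" by auto
    ultimately show ?thesis by simp
  qed
  have "(\<lambda>n. \<Sum>z\<in>?J. emeasure lebesgue {x. (z, x) \<in> A n})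
      \<longlonglongrightarrow> (\<Sum>z\<in>?J. emeasure lebesgue {x. (z, x) \<in> (\<Inter>n. A n)})"
    by (intro tendsto_sum lim)
  moreover have "(\<Inter>n. A n) \<subseteq> A 0" by auto
  ultimately show ?thesis by (simp only: eq sub)
qed

section \<open>Halfspace depth and existence of centerpoints\<close>

lemma halfspace_borel [measurable]:
  fixes a :: "'a::euclidean_space"
  shows "{x. a \<bullet> x \<le> c} \<in> sets borel" "{x. c \<le> a \<bullet> x} \<in> sets borel"
    "{x. a \<bullet> x < c} \<in> sets borel" "{x. c < a \<bullet> x} \<in> sets borel"
  by (simp_all add: borel_closed borel_open closed_halfspace_le closed_halfspace_ge
      open_halfspace_lt open_halfspace_gt)

text \<open>Only halfspaces with \<open>y\<close> on their boundary need testing: a closed halfspace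
  containing \<open>y\<close> contains its parallel translate through \<open>y\<close>.\<close>

lemma halfspace_depth_greatest:
  fixes S :: "((real ^ 'n) \<times> (real ^ 'd)) set"
  assumes S: "compact S" and m: "\<And>a. a \<noteq> 0 \<Longrightarrow> m \<le> mi_volume (S \<inter> {p. a \<bullet> y \<le> a \<bullet> p})"
  shows "m \<le> halfspace_depth S y"
  unfolding halfspace_depth_def
proof (rule INF_greatest)
  fix H assume "H \<in> {H. closed_halfspace H \<and> y \<in> H}"
  then obtain a c where a: "a \<noteq> 0" and H: "H = {p. c \<le> a \<bullet> p}" and "c \<le> a \<bullet> y"
    by (auto simp: closed_halfspace_def)
  then have "m \<le> mi_volume (S \<inter> {p. a \<bullet> y \<le> a \<bullet> p})" using m by blast
  also have "\<dots> \<le> mi_volume (S \<inter> H)"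
    using S \<open>c \<le> a \<bullet> y\<close> unfolding H
    by (intro mi_volume_mono) (auto intro: compact_imp_bounded borel_compact)
  finally show "m \<le> mi_volume (S \<inter> H)" .
qed

lemma halfspace_depth_lower:
  fixes S :: "((real ^ 'n) \<times> (real ^ 'd)) set"
  assumes "a \<noteq> 0"
  shows "halfspace_depth S y \<le> mi_volume (S \<inter> {p. a \<bullet> y \<le> a \<bullet> p})"
proof -
  have "closed_halfspace {p. a \<bullet> y \<le> a \<bullet> p}"
    unfolding closed_halfspace_def using assms by blast
  then show ?thesis
    unfolding halfspace_depth_def by (intro INF_lower) simp
qed

text \<open>Depth is upper semicontinuous on the compact set \<open>S\<close>. A maximising sequence
  has a convergent subsequence, and for each direction the halfspaces through its points eventually
  lie in slightly enlarged halfspaces that shrink to the one through the limit.\<close>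

lemma centerpoints_nonempty:
  fixes S :: "((real ^ 'n) \<times> (real ^ 'd)) set"
  assumes S: "compact S" "S \<noteq> {}"
  shows "centerpoints S \<noteq> {}"
proof -
  let ?h = "halfspace_depth S"
  obtain f :: "nat \<Rightarrow> ennreal" where f: "incseq f" "range f \<subseteq> ?h ` S" "Sup (?h ` S) = (SUP i. f i)"
    using ennreal_Sup_countable_SUP[of "?h ` S"] S(2) by auto
  then have "\<forall>n. \<exists>y\<in>S. f n = ?h y" by auto
  then obtain Y where Y: "\<And>n. Y n \<in> S" "\<And>n. f n = ?h (Y n)" by metis
  obtain y r where y: "y \<in> S" and r: "strict_mono (r :: nat \<Rightarrow> nat)" and lim: "(Y \<circ> r) \<longlonglongrightarrow> y"
    using S(1) Y(1) unfolding compact_def by metis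
  have "(SUP i. f i) \<le> ?h y"
  proof (rule halfspace_depth_greatest[OF S(1)])
    fix a :: "(real ^ 'n) \<times> (real ^ 'd)" assume a: "a \<noteq> 0"
    define A where "A m = S \<inter> {p. a \<bullet> y - 1 / real (Suc m) \<le> a \<bullet> p}" for m
    have "(\<lambda>m. mi_volume (A m)) \<longlonglongrightarrow> mi_volume (\<Inter>m. A m)"
    proof (rule mi_volume_decseq)
      show "decseq A"
      proof (rule decseq_SucI)
        fix m
        have "1 / real (Suc (Suc m)) \<le> 1 / real (Suc m)" by (intro divide_left_mono) auto
        then show "A (Suc m) \<subseteq> A m" by (auto simp: A_def)
      qed
    qed (use S in \<open>auto simp: A_def intro: compact_imp_bounded borel_compact\<close>)
    moreover have "(SUP i. f i) \<le> mi_volume (A m)" for m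
    proof (rule SUP_least)
      fix i
      have "(\<lambda>n. a \<bullet> Y (r n)) \<longlonglongrightarrow> a \<bullet> y"
        using lim by (intro tendsto_intros) (simp add: o_def)
      then have "eventually (\<lambda>n. a \<bullet> y - 1 / real (Suc m) < a \<bullet> Y (r n)) sequentially"
        by (rule order_tendstoD) simp
      then obtain n0 where n0: "\<And>n. n \<ge> n0 \<Longrightarrow> a \<bullet> y - 1 / real (Suc m) < a \<bullet> Y (r n)"
        by (auto simp: eventually_sequentially)
      \<comment> \<open>Beyond \<open>n0\<close> the halfspace through the n-th point of the
        subsequence lies in the enlarged one; being at least \<open>i\<close> gives
        \<open>i \<le> r n\<close>, so that monotonicity of \<open>f\<close> applies.\<close>
      define n where "n = max n0 i"
      have "i \<le> r n" using seq_suble[OF r, of n] by (simp add: n_def)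
      then have "f i \<le> f (r n)" using f(1) by (simp add: incseq_def)
      also have "\<dots> \<le> mi_volume (S \<inter> {p. a \<bullet> Y (r n) \<le> a \<bullet> p})"
        unfolding Y(2) by (rule halfspace_depth_lower[OF a])
      also have "\<dots> \<le> mi_volume (A m)"
        using S(1) n0[of n] unfolding A_def n_def
        by (intro mi_volume_mono) (auto intro: compact_imp_bounded borel_compact)
      finally show "f i \<le> mi_volume (A m)" .
    qed
    ultimately have "(SUP i. f i) \<le> mi_volume (\<Inter>m. A m)"
      by (intro LIMSEQ_le_const) auto
    moreover have "(\<Inter>m. A m) = S \<inter> {p. a \<bullet> y \<le> a \<bullet> p}"
    proof safe
      fix p q assume p: "(p, q) \<in> (\<Inter>m. A m)"
      show "(p, q) \<in> S" using p by (auto simp: A_def)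
      have "a \<bullet> y - a \<bullet> (p, q) \<le> 0"
      proof (rule ccontr)
        assume "\<not> ?thesis"
        then obtain m where "1 / real (Suc m) < a \<bullet> y - a \<bullet> (p, q)"
          using nat_approx_posE[of "a \<bullet> y - a \<bullet> (p, q)"] by (auto simp: not_le)
        moreover have "(p, q) \<in> A m" using p by blast
        ultimately show False by (simp add: A_def)
      qed
      then show "a \<bullet> y \<le> a \<bullet> (p, q)" by simp
    next
      fix p q m assume "(p, q) \<in> S" "a \<bullet> y \<le> a \<bullet> (p, q)"
      moreover have "0 \<le> 1 / real (Suc m)" by simp
      ultimately have "a \<bullet> y - 1 / real (Suc m) \<le> a \<bullet> (p, q)" by linarith
      with \<open>(p, q) \<in> S\<close> show "(p, q) \<in> A m" unfolding A_def by blast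
    qed
    ultimately show "(SUP i. f i) \<le> mi_volume (S \<inter> {p. a \<bullet> y \<le> a \<bullet> p})" by simp
  qed
  then have "\<forall>y'\<in>S. ?h y' \<le> ?h y"
    unfolding f(3)[symmetric] by (auto intro: order_trans[OF Sup_upper])
  with y have "y \<in> centerpoints S" by (simp add: centerpoints_def)
  then show ?thesis by blast
qed

section \<open>A deep mixed-integer point\<close>

lemma emeasure_lebesgue_eq_lborel: "A \<in> sets borel \<Longrightarrow> emeasure lebesgue A = emeasure lborel A"
  by simp

text \<open>With \<open>E = 1 / exp 1\<close> and \<open>t = N * l \<le> E / 6\<close>, the claim
  says that \<open>(1 + l) ^ N\<close> is at most \<open>(1 + E / 2) * (1 - l) ^ N\<close>. Bounding
  the left power by \<open>1 + t + t\<^sup>2\<close> and the right one by Bernoulli leaves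
  \<open>2 * t + t\<^sup>2 + t * E / 2 \<le> E / 2\<close>, which \<open>E \<le> 1 / 2\<close>
  settles.\<close>

lemma centerpoint_constant_bound:
  fixes l :: real and N :: nat
  assumes "0 < l" "l \<le> 1" "real N * l \<le> 1 / (6 * exp 1)"
  shows "(1 + l) ^ N - (1 - l) ^ N / exp 1 \<le> (1 - 1 / (2 * exp 1)) * (1 - l) ^ N"
proof -
  define E where "E = 1 / exp (1 :: real)"
  define t where "t = real N * l"
  have "2 \<le> exp (1 :: real)" using exp_ge_add_one_self[of 1] by simp
  then have E: "0 < E" "E \<le> 1 / 2" by (simp_all add: E_def field_simps)
  have t: "0 \<le> t" "t \<le> E / 6" using assms by (simp_all add: t_def E_def)
  have "(1 + l) ^ N \<le> exp l ^ N" using assms exp_ge_add_one_self[of l] by (intro power_mono) auto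
  also have "\<dots> = exp t" by (simp add: t_def exp_of_nat_mult)
  also have "\<dots> \<le> 1 + t + t\<^sup>2" using t E by (intro exp_bound) auto
  finally have up: "(1 + l) ^ N \<le> 1 + t + t\<^sup>2" .
  have low: "1 - t \<le> (1 - l) ^ N"
    using Bernoulli_inequality[of "- l" N] assms by (simp add: t_def)
  have "t\<^sup>2 \<le> (E / 6)\<^sup>2" using t by (intro power_mono) auto
  moreover have "t * E \<le> E / 6 * E" using t E by (intro mult_right_mono) auto
  moreover have "E * E \<le> 1 / 2 * E" using E by (intro mult_right_mono) auto
  moreover have "(1 + E / 2) * (1 - t) = 1 + E / 2 - t - t * E / 2" "(E / 6)\<^sup>2 = E * E / 36"
    "E / 6 * E = E * E / 6"
    by (simp_all add: field_simps power2_eq_square)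
  ultimately have "1 + t + t\<^sup>2 \<le> (1 + E / 2) * (1 - t)"
    using t E by linarith
  also have "\<dots> \<le> (1 + E / 2) * (1 - l) ^ N" using low E by (intro mult_left_mono) auto
  finally have "(1 + l) ^ N \<le> (1 + E / 2) * (1 - l) ^ N" using up by linarith
  then show ?thesis by (simp add: E_def algebra_simps)
qed

text \<open>With \<open>l = 1/(2k)\<close>, the assumption \<open>wide\<close> follows from \<open>z0 + k B \<subseteq> K\<close> for the unit cube \<open>B\<close>.\<close>

locale wide_convex_body =
  fixes C :: "((real ^ 'n) \<times> (real ^ 'd)) set" and z0 :: "real ^ 'n" and l :: real
  assumes body: "convex_body C" and l: "0 < l" "l < 1"
    and wide: "\<And>v. (\<And>i. \<bar>v $ i\<bar> \<le> 1 / 2) \<Longrightarrow> \<exists>w\<in>C. l *\<^sub>R fst w = l *\<^sub>R z0 + v"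
begin

definition S :: "((real ^ 'n) \<times> (real ^ 'd)) set" where
  "S = C \<inter> (integer_points \<times> UNIV)"

lemma compact_C: "compact C" and convex_C: "convex C"
  using body by (simp_all add: convex_body_def)

lemma compact_S: "compact S"
  unfolding S_def by (rule compact_mixed_integer[OF compact_C])

lemma S_borel: "S \<in> sets borel" and bounded_S: "bounded S"
  using compact_S by (simp_all add: borel_compact compact_imp_bounded)

section \<open>Comparison with Lebesgue measure by rounding\<close>

text \<open>Translating the fibre over \<open>nearest z\<close> by \<open>l *\<^sub>R w\<close>,
  with \<open>w\<close> from \<open>wide\<close> for the vector \<open>z - nearest z\<close>, puts
  it over \<open>z + l *\<^sub>R z0\<close>. By convexity it stays in the dilate by
  \<open>1 + l\<close>, and the value of \<open>a\<close> grows by at most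
  \<open>l * b\<close>.\<close>

lemma mi_volume_upper:
  assumes b: "\<And>x. x \<in> C \<Longrightarrow> a \<bullet> x \<le> b"
  shows "mi_volume (S \<inter> {p. a \<bullet> p < t})
    \<le> emeasure lebesgue ((\<lambda>p. (1 + l) *\<^sub>R p) ` C \<inter> {q. a \<bullet> q < t + l * b})"
proof -
  let ?W = "S \<inter> {p. a \<bullet> p < t}"
  define R where "R = (\<lambda>p. (1 + l) *\<^sub>R p) ` C \<inter> {q. a \<bullet> q < t + l * b}"
  have R: "R \<in> sets borel"
    unfolding R_def using compact_C by (intro sets.Int borel_compact compact_scaling halfspace_borel)
  have "mi_volume ?W = (\<integral>\<^sup>+z. emeasure lebesgue {x. (nearest z, x) \<in> ?W} \<partial>lborel)"
    by (intro mi_volume_eq_nn_integral bounded_fst_image bounded_Int disjI1 bounded_S)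
  also have "\<dots> \<le> (\<integral>\<^sup>+z. emeasure lborel {x. (z + l *\<^sub>R z0, x) \<in> R} \<partial>lborel)"
  proof (rule nn_integral_mono)
    fix z :: "real ^ 'n"
    have "\<bar>(z - nearest z) $ i\<bar> \<le> 1 / 2" for i
      using nearest_close[of z i] by (simp add: abs_minus_commute)
    then obtain w where w: "w \<in> C" "l *\<^sub>R fst w = l *\<^sub>R z0 + (z - nearest z)" using wide by blast
    have "emeasure lebesgue {x. (nearest z, x) \<in> ?W} \<le> emeasure lebesgue {x. (z + l *\<^sub>R z0, x) \<in> R}"
    proof (rule emeasure_lebesgue_translate_le)
      fix x assume "x \<in> {x. (nearest z, x) \<in> ?W}"
      then have p: "(nearest z, x) \<in> C" "a \<bullet> (nearest z, x) < t" by (auto simp: S_def)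
      have eq: "(z + l *\<^sub>R z0, x + l *\<^sub>R snd w) = (nearest z, x) + l *\<^sub>R w"
        using w(2) by (cases w) (simp add: algebra_simps)
      have "(1 / (1 + l)) *\<^sub>R (nearest z, x) + (l / (1 + l)) *\<^sub>R w \<in> C"
        using l by (intro convexD[OF convex_C p(1) w(1)]) (auto simp: field_simps)
      moreover have "(nearest z, x) + l *\<^sub>R w = (1 + l) *\<^sub>R ((1 / (1 + l)) *\<^sub>R (nearest z, x) + (l / (1 + l)) *\<^sub>R w)"
        unfolding scaleR_add_right scaleR_scaleR using l by simp
      ultimately have "(nearest z, x) + l *\<^sub>R w \<in> (\<lambda>p. (1 + l) *\<^sub>R p) ` C" by blast
      moreover have "a \<bullet> ((nearest z, x) + l *\<^sub>R w) < t + l * b"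
        using p(2) b[OF w(1)] l unfolding inner_add_right inner_scaleR_right
        by (intro add_less_le_mono mult_left_mono) auto
      ultimately show "x + l *\<^sub>R snd w \<in> {x. (z + l *\<^sub>R z0, x) \<in> R}"
        unfolding R_def mem_Collect_eq eq by blast
    qed (use fibre_in_sets_borel[OF R] in simp)
    then show "emeasure lebesgue {x. (nearest z, x) \<in> ?W} \<le> emeasure lborel {x. (z + l *\<^sub>R z0, x) \<in> R}"
      using emeasure_lebesgue_eq_lborel[OF fibre_in_sets_borel[OF R]] by simp
  qed
  also have "\<dots> = emeasure lebesgue R"
    unfolding emeasure_prod_shifted[OF R, of "l *\<^sub>R z0", symmetric] emeasure_lebesgue_eq_lborel[OF R] ..
  finally show ?thesis by (simp only: R_def)
qed

text \<open>The same translation in the opposite direction: a point of the dilate by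
  \<open>1 - l\<close> plus \<open>l *\<^sub>R w\<close> is a convex combination of points of
  \<open>C\<close>, and \<open>w\<close> is chosen so that it lies over
  \<open>nearest z\<close>.\<close>

lemma mi_volume_lower: "emeasure lebesgue ((\<lambda>p. (1 - l) *\<^sub>R p) ` C) \<le> mi_volume S"
proof -
  define R where "R = (\<lambda>p. (1 - l) *\<^sub>R p) ` C"
  have R: "R \<in> sets borel"
    unfolding R_def using compact_C by (intro borel_compact compact_scaling)
  have "emeasure lebesgue R = (\<integral>\<^sup>+z. emeasure lborel {x. (z + (- l *\<^sub>R z0), x) \<in> R} \<partial>lborel)"
    unfolding emeasure_lebesgue_eq_lborel[OF R] by (rule emeasure_prod_shifted[OF R])
  also have "\<dots> \<le> (\<integral>\<^sup>+z. emeasure lebesgue {x. (nearest z, x) \<in> S} \<partial>lborel)"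
  proof (rule nn_integral_mono)
    fix z :: "real ^ 'n"
    have "\<bar>(nearest z - z) $ i\<bar> \<le> 1 / 2" for i by (rule nearest_close)
    then obtain w where w: "w \<in> C" "l *\<^sub>R fst w = l *\<^sub>R z0 + (nearest z - z)" using wide by blast
    have "emeasure lebesgue {x. (z + (- l *\<^sub>R z0), x) \<in> R} \<le> emeasure lebesgue {x. (nearest z, x) \<in> S}"
    proof (rule emeasure_lebesgue_translate_le)
      fix x assume "x \<in> {x. (z + (- l *\<^sub>R z0), x) \<in> R}"
      then obtain p where p: "p \<in> C" "(z + (- l *\<^sub>R z0), x) = (1 - l) *\<^sub>R p" by (auto simp: R_def)
      have "(nearest z, x + l *\<^sub>R snd w) = (z + (- l *\<^sub>R z0), x) + l *\<^sub>R w"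
        using w(2) by (cases w) (simp add: algebra_simps)
      also have "\<dots> \<in> C"
        unfolding p(2) using l by (intro convexD[OF convex_C p(1) w(1)]) auto
      finally show "x + l *\<^sub>R snd w \<in> {x. (nearest z, x) \<in> S}"
        unfolding S_def mem_Collect_eq using nearest_in_integer_points by blast
    qed (use fibre_in_sets_borel[OF S_borel] in simp)
    then show "emeasure lborel {x. (z + (- l *\<^sub>R z0), x) \<in> R} \<le> emeasure lebesgue {x. (nearest z, x) \<in> S}"
      using emeasure_lebesgue_eq_lborel[OF fibre_in_sets_borel[OF R]] by simp
  qed
  also have "\<dots> = mi_volume S"
    by (intro mi_volume_eq_nn_integral[symmetric] bounded_fst_image bounded_S)
  finally show ?thesis by (simp only: R_def)
qed

section \<open>Depth of the rounded centroid\<close>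

lemma deep_point:
  assumes small: "real DIM((real ^ 'n) \<times> (real ^ 'd)) * l \<le> 1 / (6 * exp 1)"
  obtains y where "y \<in> S" "ennreal (1 / (2 * exp 1)) * mi_volume S \<le> halfspace_depth S y"
proof -
  let ?N = "DIM((real ^ 'n) \<times> (real ^ 'd))"
  let ?m = "measure lebesgue"
  let ?V = "?m C"
  define c where "c = centroid C"
  have c: "c \<in> C" unfolding c_def by (rule centroid_in_convex_body[OF body])
  \<comment> \<open>Chosen so that the unknown first component of \<open>w\<close> cancels:
    \<open>(1 - l) *\<^sub>R c + l *\<^sub>R w\<close> has first component exactly
    \<open>nearest \<zeta>\<close>.\<close>
  define \<zeta> where "\<zeta> = (1 - l) *\<^sub>R fst c + l *\<^sub>R z0"
  have "\<bar>(nearest \<zeta> - \<zeta>) $ i\<bar> \<le> 1 / 2" for i by (rule nearest_close)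
  then obtain w where w: "w \<in> C" "l *\<^sub>R fst w = l *\<^sub>R z0 + (nearest \<zeta> - \<zeta>)" using wide by blast
  define y where "y = (1 - l) *\<^sub>R c + l *\<^sub>R w"
  have "fst y = nearest \<zeta>" using w(2) by (simp add: y_def \<zeta>_def)
  moreover have "y \<in> C" unfolding y_def using l c w by (intro convexD[OF convex_C]) auto
  ultimately have y: "y \<in> S"
    using nearest_in_integer_points[of \<zeta>] by (simp add: S_def mem_Times_iff)
  have V: "0 < ?V" by (rule convex_body_measure_pos[OF body])
  have dilate: "?m ((\<lambda>p. r *\<^sub>R p + d) ` A) = r ^ ?N * ?m A" if "0 \<le> r" for r d and A :: "((real ^ 'n) \<times> (real ^ 'd)) set"
    using measure_lebesgue_affine[of r d A] that by simp
  define D where "D = (\<lambda>p. (1 + l) *\<^sub>R p) ` C"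
  have D: "compact D" unfolding D_def by (rule compact_scaling[OF compact_C])
  then have D_lm: "D \<in> lmeasurable" by (rule lmeasurable_compact)
  have mD: "?m D = (1 + l) ^ ?N * ?V" unfolding D_def using dilate[of "1 + l" 0 C] l by simp
  \<comment> \<open>With \<open>a = 0\<close>, \<open>b = 0\<close> and \<open>t = 1\<close> the
    halfspace conditions are vacuous, which shows that the mixed-integer volume is finite.\<close>
  have "mi_volume S \<le> emeasure lebesgue D"
    using mi_volume_upper[of 0 0 1] l by (simp add: D_def)
  also have "\<dots> < \<infinity>" using fmeasurableD2[OF D_lm] by (simp add: less_top)
  finally obtain \<sigma> where \<sigma>: "0 \<le> \<sigma>" "mi_volume S = ennreal \<sigma>"
    by (cases "mi_volume S") auto
  have "ennreal ((1 - l) ^ ?N * ?V) \<le> mi_volume S"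
  proof -
    have "compact ((\<lambda>p. (1 - l) *\<^sub>R p) ` C)" by (rule compact_scaling[OF compact_C])
    then have "emeasure lebesgue ((\<lambda>p. (1 - l) *\<^sub>R p) ` C) = ennreal (?m ((\<lambda>p. (1 - l) *\<^sub>R p) ` C))"
      by (intro emeasure_eq_measure2 lmeasurable_compact)
    then show ?thesis using mi_volume_lower dilate[of "1 - l" 0 C] l by simp
  qed
  then have \<sigma>_lower: "(1 - l) ^ ?N * ?V \<le> \<sigma>"
    using \<sigma> by (simp add: ennreal_le_iff)
  have "ennreal (1 / (2 * exp 1)) * mi_volume S \<le> halfspace_depth S y"
  proof (rule halfspace_depth_greatest[OF compact_S])
    fix a :: "(real ^ 'n) \<times> (real ^ 'd)"
    have "continuous_on C (\<lambda>x. a \<bullet> x)" by (intro continuous_intros)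
    then obtain v where v: "v \<in> C" "\<And>x. x \<in> C \<Longrightarrow> a \<bullet> x \<le> a \<bullet> v"
      using continuous_attains_sup[OF compact_C] c by blast
    \<comment> \<open>The level that \<open>mi_volume_upper\<close> attaches to the cut of
      \<open>S\<close> at \<open>a \<bullet> y\<close>, with
      \<open>b = a \<bullet> v\<close>.\<close>
    define t where "t = a \<bullet> y + l * (a \<bullet> v)"
    have t: "t \<le> (1 - l) * (a \<bullet> c) + 2 * l * (a \<bullet> v)"
      using mult_left_mono[OF v(2)[OF w(1)], of l] l by (simp add: t_def y_def inner_add_right)
    \<comment> \<open>A copy of the centroid's cap inside \<open>D\<close> beyond level
      \<open>t\<close>. The summand \<open>2 * l * (a \<bullet> v)\<close> pays once for the shift
      in \<open>t\<close> and once for the rounding point \<open>w\<close>, as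
      \<open>a \<bullet> w \<le> a \<bullet> v\<close>; the weights \<open>1 - l\<close> and
      \<open>2 * l\<close> add up to \<open>1 + l\<close>, so \<open>Q\<close> stays in
      \<open>D\<close>.\<close>
    define Q where "Q = (\<lambda>p. (1 - l) *\<^sub>R p + (2 * l) *\<^sub>R v) ` (C \<inter> {p. a \<bullet> c \<le> a \<bullet> p})"
    have "compact (C \<inter> {p. a \<bullet> c \<le> a \<bullet> p})"
      using compact_C by (intro compact_Int_closed closed_halfspace_ge)
    then have "compact Q" unfolding Q_def by (intro compact_continuous_image continuous_intros)
    then have Q_lm: "Q \<in> lmeasurable" by (rule lmeasurable_compact)
    have Q_sub: "Q \<subseteq> D \<inter> {q. t \<le> a \<bullet> q}"
    proof
      fix q assume "q \<in> Q"
      then obtain p where p: "p \<in> C" "a \<bullet> c \<le> a \<bullet> p" "q = (1 - l) *\<^sub>R p + (2 * l) *\<^sub>R v"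
        by (auto simp: Q_def)
      have "(1 - l) / (1 + l) + 2 * l / (1 + l) = (1 + l) / (1 + l)"
        unfolding add_divide_distrib[symmetric] by simp
      then have "((1 - l) / (1 + l)) *\<^sub>R p + (2 * l / (1 + l)) *\<^sub>R v \<in> C"
        using l by (intro convexD[OF convex_C p(1) v(1)]) simp_all
      moreover have "q = (1 + l) *\<^sub>R (((1 - l) / (1 + l)) *\<^sub>R p + (2 * l / (1 + l)) *\<^sub>R v)"
        unfolding scaleR_add_right scaleR_scaleR p(3) using l by simp
      ultimately have "q \<in> D" unfolding D_def by blast
      moreover have "t \<le> a \<bullet> q"
      proof -
        have "a \<bullet> q = (1 - l) * (a \<bullet> p) + 2 * l * (a \<bullet> v)"
          by (simp add: p(3) inner_add_right)
        moreover have "(1 - l) * (a \<bullet> c) \<le> (1 - l) * (a \<bullet> p)"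
          using p(2) l by (intro mult_left_mono) auto
        ultimately show ?thesis using t by linarith
      qed
      ultimately show "q \<in> D \<inter> {q. t \<le> a \<bullet> q}" by blast
    qed
    define R where "R = D \<inter> {q. a \<bullet> q < t}"
    have R_lm: "R \<in> lmeasurable"
      unfolding R_def using D_lm halfspace_borel(3)[of a t] by (intro fmeasurable_Int_fmeasurable) auto
    have "R \<inter> Q = {}" using Q_sub by (fastforce simp: R_def)
    then have "?m R + ?m Q = ?m (R \<union> Q)"
      using measure_Un3[OF R_lm Q_lm] by simp
    also have "\<dots> \<le> ?m D"
      using R_lm Q_lm Q_sub D_lm by (intro measure_mono_fmeasurable) (auto simp: R_def)
    finally have RQ: "?m R + ?m Q \<le> (1 + l) ^ ?N * ?V" by (simp only: mD)
    \<comment> \<open>By Gruenbaum, \<open>Q\<close> takes at least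
      \<open>(1 - l) ^ ?N * ?V / exp 1\<close> away from the volume of \<open>D\<close>; the rest
      bounds the volume of \<open>R\<close>, hence the part of \<open>S\<close> strictly below
      \<open>y\<close>.\<close>
    have "(1 - l) ^ ?N * (?V / exp 1) \<le> (1 - l) ^ ?N * ?m (C \<inter> {p. a \<bullet> c \<le> a \<bullet> p})"
      unfolding c_def using l by (intro mult_left_mono grunbaum_inequality[OF body]) auto
    also have "\<dots> = ?m Q" unfolding Q_def using l by (subst dilate) auto
    finally have "?m R \<le> ((1 + l) ^ ?N - (1 - l) ^ ?N / exp 1) * ?V"
      using RQ by (simp add: algebra_simps)
    also have "\<dots> \<le> ((1 - 1 / (2 * exp 1)) * (1 - l) ^ ?N) * ?V"
      using l V small by (intro mult_right_mono centerpoint_constant_bound) auto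
    also have "\<dots> \<le> (1 - 1 / (2 * exp 1)) * \<sigma>"
    proof -
      have "1 \<le> exp (1 :: real)" by simp
      then have "1 / (2 * exp (1 :: real)) \<le> 1" by (subst divide_le_eq_1_pos) linarith+
      then have "0 \<le> 1 - 1 / (2 * exp (1 :: real))" by simp
      then show ?thesis using mult_left_mono[OF \<sigma>_lower] by (simp only: mult.assoc)
    qed
    finally have mR: "?m R \<le> (1 - 1 / (2 * exp 1)) * \<sigma>" .
    let ?W = "S \<inter> {p. a \<bullet> p < a \<bullet> y}" and ?H = "S \<inter> {p. a \<bullet> y \<le> a \<bullet> p}"
    have "mi_volume ?W \<le> emeasure lebesgue R"
      unfolding R_def D_def t_def by (rule mi_volume_upper[OF v(2)])
    also have "\<dots> = ennreal (?m R)" using R_lm by (rule emeasure_eq_measure2)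
    also have "\<dots> \<le> ennreal ((1 - 1 / (2 * exp 1)) * \<sigma>)" using mR by (rule ennreal_leI)
    finally have W: "mi_volume ?W \<le> ennreal ((1 - 1 / (2 * exp 1)) * \<sigma>)" .
    have "mi_volume (?W \<union> ?H) = mi_volume ?W + mi_volume ?H"
      using S_borel bounded_S by (intro mi_volume_Un_disjoint) auto
    moreover have "?W \<union> ?H = S" by auto
    ultimately have sum: "ennreal \<sigma> = mi_volume ?W + mi_volume ?H" using \<sigma>(2) by simp
    then obtain \<omega> \<eta> where \<omega>: "0 \<le> \<omega>" "mi_volume ?W = ennreal \<omega>" and \<eta>: "0 \<le> \<eta>" "mi_volume ?H = ennreal \<eta>"
      by (cases "mi_volume ?W"; cases "mi_volume ?H") auto
    have "\<sigma> = \<omega> + \<eta>" using sum \<sigma> \<omega> \<eta> by (simp flip: ennreal_plus)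
    moreover have "\<omega> \<le> (1 - 1 / (2 * exp 1)) * \<sigma>"
    proof -
      have "0 \<le> (1 - 1 / (2 * exp 1)) * \<sigma>" using mR measure_nonneg[of lebesgue R] by linarith
      then show ?thesis using W \<omega> by (simp add: ennreal_le_iff)
    qed
    ultimately have "1 / (2 * exp 1) * \<sigma> \<le> \<eta>" by (simp add: algebra_simps)
    then have "ennreal (1 / (2 * exp 1) * \<sigma>) \<le> ennreal \<eta>" by (rule ennreal_leI)
    then show "ennreal (1 / (2 * exp 1)) * mi_volume S \<le> mi_volume ?H"
      by (simp only: \<sigma>(2) \<eta>(2) ennreal_mult''[OF \<sigma>(1)])
  qed
  with y show thesis by (rule that)
qed

end

section \<open>From the cube hypothesis to the final estimate\<close>

text \<open>The vector \<open>2 *\<^sub>R v\<close> lies in the sup-norm ball, so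
  \<open>z0 + (2 * k) *\<^sub>R v\<close> lifts to a point of \<open>C\<close>; multiplication by
  \<open>1 / (2 * k)\<close> returns \<open>v\<close>. Hence the choice of \<open>l\<close>.\<close>

lemma lift_from_cube:
  fixes C :: "((real ^ 'n) \<times> (real ^ 'd)) set" and z0 v :: "real ^ 'n"
  assumes k: "0 < k" and cube: "(\<lambda>u. z0 + k *\<^sub>R u) ` sup_norm_ball \<subseteq> fst ` C"
    and v: "\<And>i. \<bar>v $ i\<bar> \<le> 1 / 2"
  shows "\<exists>w\<in>C. (1 / (2 * k)) *\<^sub>R fst w = (1 / (2 * k)) *\<^sub>R z0 + v"
proof -
  have "infnorm (2 *\<^sub>R v) \<le> 1"
    unfolding infnorm_cart
  proof (rule cSup_least)
    fix x assume "x \<in> {\<bar>(2 *\<^sub>R v) $ i\<bar> |i. i \<in> UNIV}"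
    then obtain i where "x = \<bar>2 * v $ i\<bar>" by auto
    then show "x \<le> 1" using v[of i] by (simp add: abs_mult)
  qed auto
  then have "z0 + k *\<^sub>R (2 *\<^sub>R v) \<in> fst ` C"
    by (intro subsetD[OF cube] imageI) (simp add: sup_norm_ball_def)
  then obtain w where w: "w \<in> C" "fst w = z0 + k *\<^sub>R (2 *\<^sub>R v)" by auto
  have "(1 / (2 * k)) *\<^sub>R fst w = (1 / (2 * k)) *\<^sub>R z0 + v"
    unfolding w(2) scaleR_add_right scaleR_scaleR using k by simp
  with w(1) show ?thesis by blast
qed

theorem corollary2p5:
  fixes C S :: "((real ^ 'n) \<times> (real ^ 'd)) set"
    and K :: "(real ^ 'n) set"
    and z0 :: "real ^ 'n" and k :: real
  assumes "convex_body C"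
    and "S = C \<inter> (integer_points \<times> UNIV)"
    and "K = fst ` C"
    and "k \<ge> 3 * exp 1 * (real CARD('n) + real CARD('d))"
    and "(\<lambda>u. z0 + k *\<^sub>R u) ` sup_norm_ball \<subseteq> K"
  shows "centerpoints S \<noteq> {} \<and>
    (\<forall>y\<in>centerpoints S.
       halfspace_depth S y \<ge> ennreal (1 / (2 * exp 1)) * mi_volume S \<and>
       ennreal (1 / (2 * exp 1)) * mi_volume S
         \<ge> ennreal (1 / (2 ^ CARD('n) * exp 1)) * mi_volume S)"
proof -
  define N where "N = real CARD('n) + real CARD('d)"
  define l where "l = 1 / (2 * k)"
  have "1 \<le> exp (1 :: real)" by simp
  moreover have N: "1 \<le> N"
    using zero_less_card_finite[where 'a = 'n] unfolding N_def by linarith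
  ultimately have "3 * 1 * 1 \<le> 3 * exp 1 * N" by (intro mult_mono) auto
  then have k: "1 < k" using assms(4) by (simp add: N_def)
  interpret W: wide_convex_body C z0 l
  proof
    show "convex_body C" by (rule assms(1))
    show "0 < l" "l < 1" using k by (simp_all add: l_def)
    show "\<exists>w\<in>C. l *\<^sub>R fst w = l *\<^sub>R z0 + v" if "\<And>i. \<bar>v $ i\<bar> \<le> 1 / 2" for v
      unfolding l_def using k assms(3,5) that by (intro lift_from_cube) auto
  qed
  have S: "W.S = S" by (simp add: W.S_def assms(2))
  \<comment> \<open>The constant in the lower bound on \<open>k\<close> is what makes
    \<open>N * l\<close> at most \<open>1 / (6 * exp 1)\<close>, the smallness required by
    \<open>deep_point\<close>.\<close>
  have "N * (6 * exp 1) \<le> 2 * k" using assms(4) by (simp add: N_def algebra_simps)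
  then have "N * l \<le> 1 / (6 * exp 1)" using k by (simp add: l_def field_simps)
  then have "real DIM((real ^ 'n) \<times> (real ^ 'd)) * l \<le> 1 / (6 * exp 1)" by (simp add: N_def)
  then obtain y0 where y0: "y0 \<in> S" "ennreal (1 / (2 * exp 1)) * mi_volume S \<le> halfspace_depth S y0"
    using W.deep_point[unfolded S] by blast
  have "centerpoints S \<noteq> {}"
    using centerpoints_nonempty[of S] W.compact_S y0(1) S by auto
  moreover have "ennreal (1 / (2 * exp 1)) * mi_volume S \<le> halfspace_depth S y"
    if "y \<in> centerpoints S" for y
    using that y0 by (auto simp: centerpoints_def intro: order_trans)
  moreover have "ennreal (1 / (2 ^ CARD('n) * exp 1)) * mi_volume S \<le> ennreal (1 / (2 * exp 1)) * mi_volume S"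
  proof -
    have "(2 :: real) ^ 1 \<le> 2 ^ CARD('n)"
      using zero_less_card_finite[where 'a = 'n] by (intro power_increasing) auto
    then have "1 / (2 ^ CARD('n) * exp 1) \<le> 1 / (2 * exp (1 :: real))"
      by (intro divide_left_mono mult_right_mono) auto
    then show ?thesis by (intro mult_right_mono ennreal_leI) auto
  qed
  ultimately show ?thesis by blast
qed

end
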